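(* Let $\mathcal{C}$ be an abelian category and $m,n\ge1$. Let $\mathcal{A}\subseteq\mathcal{C}$ be a class closed under extensions and under epikernels (kernels of epimorphisms between objects of $\mathcal{A}$), with $0\in\mathcal{A}$ and $\mathrm{Ext}^1(\mathcal{A},\mathcal{A})=0$, and let $\mathcal{B}\subseteq\mathcal{C}$ be a class with $\mathrm{Ext}^1(\mathcal{A},\mathcal{B})=0$. Then \[\pi\mathcal{GP}^{\mathrm{ppr}}_{(\mathcal{A},\mathcal{B},n)}\cap\pi\mathcal{GP}^{\mathrm{ppr}}_{(\mathcal{A},\mathcal{B},m)}=\pi\mathcal{GP}^{\mathrm{ppr}}_{(\mathcal{A},\mathcal{B},(m,n))},\] where $(m,n)$ is the greatest common divisor of $m$ and $n$.
   Context: An $\mathcal{A}$-loop at $M$ of length $r$ is an exact chain complex $A_\bullet$ with components in $\mathcal{A}$ and $Z_{kr}(A_\bullet)\cong M$ for every $k\in\mathbb{Z}$ ($Z_k$ = $k$-th cycle). $\pi\mathcal{GP}^{\mathrm{ppr}}_{(\mathcal{A},\mathcal{B},r)}$ is the class of objects $M$ admitting an $\mathcal{A}$-loop at $M$ of length $r$ which is $\mathrm{Hom}(\mathcal{A},-)$-acyclic ($\mathrm{Hom}(A,-)$ applied gives an exact complex for all $A\in\mathcal{A}$) and $\mathrm{Hom}(-,\mathcal{B})$-acyclic ($\mathrm{Hom}(-,B)$ applied gives an exact complex for all $B\in\mathcal{B}$). *)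

theory Defs
  imports Main
begin

record ('o, 'm) cat =
  Obj :: "'o set"
  Hom :: "'o \<Rightarrow> 'o \<Rightarrow> 'm set"
  cmp :: "'m \<Rightarrow> 'm \<Rightarrow> 'm"
  idm :: "'o \<Rightarrow> 'm"

definition category :: "('o, 'm) cat \<Rightarrow> bool" where
  "category C \<longleftrightarrow>
     (\<forall>a b. (a \<notin> Obj C \<or> b \<notin> Obj C) \<longrightarrow> Hom C a b = {}) \<and>
     (\<forall>a b a' b'. Hom C a b \<inter> Hom C a' b' \<noteq> {} \<longrightarrow> a = a' \<and> b = b') \<and>
     (\<forall>a \<in> Obj C. idm C a \<in> Hom C a a) \<and>
     (\<forall>a b c f g. f \<in> Hom C b c \<longrightarrow> g \<in> Hom C a b \<longrightarrow> cmp C f g \<in> Hom C a c) \<and>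
     (\<forall>a b f. f \<in> Hom C a b \<longrightarrow> cmp C (idm C b) f = f \<and> cmp C f (idm C a) = f) \<and>
     (\<forall>a b c d f g h. f \<in> Hom C c d \<longrightarrow> g \<in> Hom C b c \<longrightarrow> h \<in> Hom C a b \<longrightarrow>
        cmp C (cmp C f g) h = cmp C f (cmp C g h))"

definition mono :: "('o, 'm) cat \<Rightarrow> 'o \<Rightarrow> 'o \<Rightarrow> 'm \<Rightarrow> bool" where
  "mono C a b f \<longleftrightarrow> f \<in> Hom C a b \<and>
     (\<forall>x g h. g \<in> Hom C x a \<longrightarrow> h \<in> Hom C x a \<longrightarrow> cmp C f g = cmp C f h \<longrightarrow> g = h)"

definition epi :: "('o, 'm) cat \<Rightarrow> 'o \<Rightarrow> 'o \<Rightarrow> 'm \<Rightarrow> bool" where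
  "epi C a b f \<longleftrightarrow> f \<in> Hom C a b \<and>
     (\<forall>x g h. g \<in> Hom C b x \<longrightarrow> h \<in> Hom C b x \<longrightarrow> cmp C g f = cmp C h f \<longrightarrow> g = h)"

definition zero_obj :: "('o, 'm) cat \<Rightarrow> 'o \<Rightarrow> bool" where
  "zero_obj C z \<longleftrightarrow> z \<in> Obj C \<and>
     (\<forall>a \<in> Obj C. (\<exists>!f. f \<in> Hom C z a) \<and> (\<exists>!f. f \<in> Hom C a z))"

definition is_zero :: "('o, 'm) cat \<Rightarrow> 'o \<Rightarrow> 'o \<Rightarrow> 'm \<Rightarrow> bool" where
  "is_zero C a b f \<longleftrightarrow> f \<in> Hom C a b \<and>
     (\<exists>z g h. zero_obj C z \<and> g \<in> Hom C a z \<and> h \<in> Hom C z b \<and> f = cmp C h g)"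

definition is_kernel :: "('o, 'm) cat \<Rightarrow> 'm \<Rightarrow> 'o \<Rightarrow> 'o \<Rightarrow> 'm \<Rightarrow> 'o \<Rightarrow> bool" where
  "is_kernel C k K a f b \<longleftrightarrow> k \<in> Hom C K a \<and> f \<in> Hom C a b \<and> is_zero C K b (cmp C f k) \<and>
     (\<forall>x g. g \<in> Hom C x a \<longrightarrow> is_zero C x b (cmp C f g) \<longrightarrow>
        (\<exists>!u. u \<in> Hom C x K \<and> cmp C k u = g))"

definition is_cokernel :: "('o, 'm) cat \<Rightarrow> 'm \<Rightarrow> 'o \<Rightarrow> 'o \<Rightarrow> 'm \<Rightarrow> 'o \<Rightarrow> bool" where
  "is_cokernel C c Q b f a \<longleftrightarrow> c \<in> Hom C b Q \<and> f \<in> Hom C a b \<and> is_zero C a Q (cmp C c f) \<and>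
     (\<forall>x g. g \<in> Hom C b x \<longrightarrow> is_zero C a x (cmp C g f) \<longrightarrow>
        (\<exists>!u. u \<in> Hom C Q x \<and> cmp C u c = g))"

definition is_product :: "('o, 'm) cat \<Rightarrow> 'o \<Rightarrow> 'm \<Rightarrow> 'm \<Rightarrow> 'o \<Rightarrow> 'o \<Rightarrow> bool" where
  "is_product C P p1 p2 a b \<longleftrightarrow> p1 \<in> Hom C P a \<and> p2 \<in> Hom C P b \<and>
     (\<forall>x f g. f \<in> Hom C x a \<longrightarrow> g \<in> Hom C x b \<longrightarrow>
        (\<exists>!u. u \<in> Hom C x P \<and> cmp C p1 u = f \<and> cmp C p2 u = g))"

definition is_coproduct :: "('o, 'm) cat \<Rightarrow> 'o \<Rightarrow> 'm \<Rightarrow> 'm \<Rightarrow> 'o \<Rightarrow> 'o \<Rightarrow> bool" where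
  "is_coproduct C S i1 i2 a b \<longleftrightarrow> i1 \<in> Hom C a S \<and> i2 \<in> Hom C b S \<and>
     (\<forall>x f g. f \<in> Hom C a x \<longrightarrow> g \<in> Hom C b x \<longrightarrow>
        (\<exists>!u. u \<in> Hom C S x \<and> cmp C u i1 = f \<and> cmp C u i2 = g))"

text \<open>Abelian category (Freyd's characterisation): zero object, binary products and
  coproducts, kernels and cokernels, every mono is a kernel, every epi is a cokernel.\<close>
definition abelian_category :: "('o, 'm) cat \<Rightarrow> bool" where
  "abelian_category C \<longleftrightarrow> category C \<and>
     (\<exists>z. zero_obj C z) \<and>
     (\<forall>a \<in> Obj C. \<forall>b \<in> Obj C. \<exists>P p1 p2. is_product C P p1 p2 a b) \<and>
     (\<forall>a \<in> Obj C. \<forall>b \<in> Obj C. \<exists>S i1 i2. is_coproduct C S i1 i2 a b) \<and>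
     (\<forall>a b f. f \<in> Hom C a b \<longrightarrow> (\<exists>k K. is_kernel C k K a f b)) \<and>
     (\<forall>a b f. f \<in> Hom C a b \<longrightarrow> (\<exists>c Q. is_cokernel C c Q b f a)) \<and>
     (\<forall>a b f. mono C a b f \<longrightarrow> (\<exists>g c. is_kernel C f a b g c)) \<and>
     (\<forall>a b f. epi C a b f \<longrightarrow> (\<exists>g c. is_cokernel C f b a g c))"

definition short_exact :: "('o, 'm) cat \<Rightarrow> 'o \<Rightarrow> 'm \<Rightarrow> 'o \<Rightarrow> 'm \<Rightarrow> 'o \<Rightarrow> bool" where
  "short_exact C X f E g Y \<longleftrightarrow> is_kernel C f X E g Y \<and> is_cokernel C g Y E f X"

text \<open>Ext^1(X,Y) = 0 (Yoneda): every short exact sequence 0 \<rightarrow> Y \<rightarrow> E \<rightarrow> X \<rightarrow> 0 splits.\<close>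
definition ext1_zero :: "('o, 'm) cat \<Rightarrow> 'o \<Rightarrow> 'o \<Rightarrow> bool" where
  "ext1_zero C X Y \<longleftrightarrow> (\<forall>f E g. short_exact C Y f E g X \<longrightarrow>
      (\<exists>r. r \<in> Hom C E Y \<and> cmp C r f = idm C Y))"

definition ext1_vanish :: "('o, 'm) cat \<Rightarrow> 'o set \<Rightarrow> 'o set \<Rightarrow> bool" where
  "ext1_vanish C \<A> \<B> \<longleftrightarrow> (\<forall>X \<in> \<A>. \<forall>Y \<in> \<B>. ext1_zero C X Y)"

definition closed_under_extensions :: "('o, 'm) cat \<Rightarrow> 'o set \<Rightarrow> bool" where
  "closed_under_extensions C \<A> \<longleftrightarrow>
     (\<forall>X f E g Y. short_exact C X f E g Y \<longrightarrow> X \<in> \<A> \<longrightarrow> Y \<in> \<A> \<longrightarrow> E \<in> \<A>)"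

definition closed_under_epikernels :: "('o, 'm) cat \<Rightarrow> 'o set \<Rightarrow> bool" where
  "closed_under_epikernels C \<A> \<longleftrightarrow>
     (\<forall>X Y g k K. X \<in> \<A> \<longrightarrow> Y \<in> \<A> \<longrightarrow> epi C X Y g \<longrightarrow> is_kernel C k K X g Y \<longrightarrow> K \<in> \<A>)"

definition chain_complex :: "('o, 'm) cat \<Rightarrow> (int \<Rightarrow> 'o) \<Rightarrow> (int \<Rightarrow> 'm) \<Rightarrow> bool" where
  "chain_complex C A d \<longleftrightarrow> (\<forall>k. A k \<in> Obj C \<and> d k \<in> Hom C (A k) (A (k - 1)) \<and>
      is_zero C (A (k + 1)) (A (k - 1)) (cmp C (d k) (d (k + 1))))"

definition exact_complex :: "('o, 'm) cat \<Rightarrow> (int \<Rightarrow> 'o) \<Rightarrow> (int \<Rightarrow> 'm) \<Rightarrow> bool" where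
  "exact_complex C A d \<longleftrightarrow> chain_complex C A d \<and>
     (\<forall>k. \<exists>\<iota> K e. is_kernel C \<iota> K (A k) (d k) (A (k - 1)) \<and> epi C (A (k + 1)) K e \<and>
          d (k + 1) = cmp C \<iota> e)"

definition Hom_left_acyclic :: "('o, 'm) cat \<Rightarrow> 'o set \<Rightarrow> (int \<Rightarrow> 'o) \<Rightarrow> (int \<Rightarrow> 'm) \<Rightarrow> bool" where
  "Hom_left_acyclic C \<A> A d \<longleftrightarrow> (\<forall>X \<in> \<A>. \<forall>k.
     {f \<in> Hom C X (A k). is_zero C X (A (k - 1)) (cmp C (d k) f)} =
     (\<lambda>g. cmp C (d (k + 1)) g) ` Hom C X (A (k + 1)))"

definition Hom_right_acyclic :: "('o, 'm) cat \<Rightarrow> 'o set \<Rightarrow> (int \<Rightarrow> 'o) \<Rightarrow> (int \<Rightarrow> 'm) \<Rightarrow> bool" where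
  "Hom_right_acyclic C \<B> A d \<longleftrightarrow> (\<forall>Y \<in> \<B>. \<forall>k.
     {f \<in> Hom C (A k) Y. is_zero C (A (k + 1)) Y (cmp C f (d (k + 1)))} =
     (\<lambda>g. cmp C g (d k)) ` Hom C (A (k - 1)) Y)"

text \<open>\<A>-loop at M of length r: exact complex with components in \<A> and Z_{kr} \<cong> M
  (i.e. M is a kernel object of d (k r)) for all integers k.\<close>
definition is_loop :: "('o, 'm) cat \<Rightarrow> 'o set \<Rightarrow> 'o \<Rightarrow> nat \<Rightarrow> (int \<Rightarrow> 'o) \<Rightarrow> (int \<Rightarrow> 'm) \<Rightarrow> bool" where
  "is_loop C \<A> M r A d \<longleftrightarrow> exact_complex C A d \<and> (\<forall>k. A k \<in> \<A>) \<and>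
     (\<forall>k::int. \<exists>\<iota>. is_kernel C \<iota> M (A (k * int r)) (d (k * int r)) (A (k * int r - 1)))"

definition piGP :: "('o, 'm) cat \<Rightarrow> 'o set \<Rightarrow> 'o set \<Rightarrow> nat \<Rightarrow> 'o set" where
  "piGP C \<A> \<B> r = {M \<in> Obj C. \<exists>A d. is_loop C \<A> M r A d \<and>
      Hom_left_acyclic C \<A> A d \<and> Hom_right_acyclic C \<B> A d}"

end

theory Submission
  imports Defs
begin

text \<open>
  Write \<open>(M, Z) \<in> syz\<close> if there is an exact sequence \<open>0 \<rightarrow> Z \<rightarrow> A \<rightarrow> M \<rightarrow> 0\<close> with \<open>A \<in> \<A>\<close> that stays
  exact under \<open>Hom(\<A>, -)\<close> and \<open>Hom(-, \<B>)\<close>. Cutting a loop into short exact sequences, and splicing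
  them periodically, shows that \<open>M\<close> admits an acyclic loop of length \<open>r \<ge> 1\<close> iff \<open>(M, M) \<in> syz ^^ r\<close>.
  Call \<open>M\<close> and \<open>N\<close> stably isomorphic if \<open>M \<oplus> P \<cong> N \<oplus> Q\<close> with \<open>P, Q \<in> \<A>\<close>. By Schanuel's lemma two
  syzygies of the same object are stably isomorphic, and conversely stably isomorphic objects have
  literally the same syzygies, because summands from \<open>\<A>\<close> can be added to the middle term or split
  off from it (\<open>\<A>\<close> is closed under epikernels). Hence for \<open>n < m\<close> a closed \<open>syz\<close>-path of length \<open>m\<close>
  at \<open>M\<close> reaches after \<open>n\<close> steps an object stably isomorphic to \<open>M\<close>, whose next step can be started
  at \<open>M\<close> itself; this gives a closed path of length \<open>m - n\<close>, and the Euclidean algorithm finishes.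

  No additive structure on the Hom sets is constructed: from Freyd's axioms it is shown directly that
  the middle term of a split short exact sequence is both a product and a coproduct.
\<close>

section \<open>Opposite category\<close>

text \<open>Duality device: facts on kernels, monos and equalizers proved for every abelian category
  are applied to \<open>op_cat C\<close>, and the simp rules below translate them back into facts on
  cokernels, epis and coequalizers.\<close>

definition op_cat :: "('o, 'm) cat \<Rightarrow> ('o, 'm) cat" where
  "op_cat C = \<lparr>Obj = Obj C, Hom = (\<lambda>a b. Hom C b a), cmp = (\<lambda>f g. cmp C g f), idm = idm C\<rparr>"

lemma op_cat_sel [simp]:
  "Obj (op_cat C) = Obj C" "Hom (op_cat C) a b = Hom C b a"
  "cmp (op_cat C) f g = cmp C g f" "idm (op_cat C) = idm C"
  by (simp_all add: op_cat_def)

lemma zero_obj_op [simp]: "zero_obj (op_cat C) z = zero_obj C z"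
  unfolding zero_obj_def by auto

lemma is_zero_op [simp]: "is_zero (op_cat C) a b f = is_zero C b a f"
  unfolding is_zero_def by auto

lemma is_kernel_op [simp]: "is_kernel (op_cat C) = is_cokernel C"
  unfolding is_kernel_def is_cokernel_def fun_eq_iff by simp

lemma is_cokernel_op [simp]: "is_cokernel (op_cat C) = is_kernel C"
  unfolding is_kernel_def is_cokernel_def fun_eq_iff by simp

lemma is_product_op [simp]: "is_product (op_cat C) = is_coproduct C"
  unfolding is_product_def is_coproduct_def fun_eq_iff by simp

lemma is_coproduct_op [simp]: "is_coproduct (op_cat C) = is_product C"
  unfolding is_product_def is_coproduct_def fun_eq_iff by simp

lemma mono_op [simp]: "mono (op_cat C) a b f = epi C b a f"
  unfolding mono_def epi_def by simp

lemma epi_op [simp]: "epi (op_cat C) a b f = mono C b a f"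
  unfolding mono_def epi_def by simp

lemma category_op: "category C \<Longrightarrow> category (op_cat C)"
  unfolding category_def op_cat_sel by (intro conjI) (blast | metis)+

lemma abelian_category_op: "abelian_category C \<Longrightarrow> abelian_category (op_cat C)"
  unfolding abelian_category_def by (auto simp: category_op)

section \<open>Abelian categories\<close>

locale abelian =
  fixes C :: "('o, 'm) cat"
  assumes abelian: "abelian_category C"
begin

section \<open>Arrows with source and target\<close>

abbreviation comp (infixr "\<cdot>" 70) where "f \<cdot> g \<equiv> cmp C f g"

text \<open>Hom sets are disjoint, so a morphism determines its source and target. Via
  \<open>in_Hom\<close>, membership in a Hom set splits into equations that the simplifier can
  discharge.\<close>

definition arr where "arr f \<longleftrightarrow> (\<exists>a b. f \<in> Hom C a b)"
definition src where "src f = (THE a. \<exists>b. f \<in> Hom C a b)"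
definition tgt where "tgt f = (THE b. \<exists>a. f \<in> Hom C a b)"
definition zm where "zm a b = (THE f. is_zero C a b f)"

lemma category: "category C"
  using abelian by (simp add: abelian_category_def)

lemma op_abelian: "abelian (op_cat C)"
  by (simp add: abelian.intro abelian abelian_category_op)

lemma Hom_unique: "f \<in> Hom C a b \<Longrightarrow> f \<in> Hom C a' b' \<Longrightarrow> a = a' \<and> b = b'"
  using category unfolding category_def by (elim conjE) (metis IntI empty_iff)

lemma in_Hom: "f \<in> Hom C a b \<longleftrightarrow> arr f \<and> src f = a \<and> tgt f = b"
proof -
  have "src f = a \<and> tgt f = b" if "f \<in> Hom C a b" for a b
    using that unfolding src_def tgt_def by (auto dest: Hom_unique)
  then show ?thesis unfolding arr_def by blast
qed

lemma comp_in_Hom: "f \<in> Hom C b c \<Longrightarrow> g \<in> Hom C a b \<Longrightarrow> f \<cdot> g \<in> Hom C a c"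
  using category unfolding category_def by blast

lemma comp_arr [simp]:
  assumes "arr f" "arr g" "src f = tgt g"
  shows "arr (f \<cdot> g)" "src (f \<cdot> g) = src g" "tgt (f \<cdot> g) = tgt f"
  using comp_in_Hom[of f "src f" "tgt f" g "src g"] assms by (auto simp: in_Hom)

lemma src_tgt_Obj [simp]: "arr f \<Longrightarrow> src f \<in> Obj C" "arr f \<Longrightarrow> tgt f \<in> Obj C"
  using category in_Hom[of f "src f" "tgt f"] unfolding category_def by (metis empty_iff)+

lemma Hom_Obj: "f \<in> Hom C a b \<Longrightarrow> a \<in> Obj C \<and> b \<in> Obj C"
  by (auto simp: in_Hom)

lemma id_arr [simp]:
  assumes "a \<in> Obj C" shows "arr (idm C a)" "src (idm C a) = a" "tgt (idm C a) = a"
proof -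
  have "idm C a \<in> Hom C a a" using category assms unfolding category_def by blast
  then show "arr (idm C a)" "src (idm C a) = a" "tgt (idm C a) = a" by (auto simp: in_Hom)
qed

lemma comp_id [simp]: "arr f \<Longrightarrow> tgt f = b \<Longrightarrow> idm C b \<cdot> f = f"
    "arr f \<Longrightarrow> src f = a \<Longrightarrow> f \<cdot> idm C a = f"
  using category in_Hom[of f "src f" "tgt f"] unfolding category_def by metis+

lemma comp_assoc [simp]:
  "arr f \<Longrightarrow> arr g \<Longrightarrow> arr h \<Longrightarrow> src f = tgt g \<Longrightarrow> src g = tgt h \<Longrightarrow> (f \<cdot> g) \<cdot> h = f \<cdot> g \<cdot> h"
  using category in_Hom[of f "src f" "tgt f"] in_Hom[of g "src g" "tgt g"] in_Hom[of h "src h" "tgt h"]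
  unfolding category_def by metis

text \<open>As \<open>comp_assoc\<close> brackets composites to the right, an equation for
  \<open>a \<cdot> b\<close> no longer matches inside \<open>a \<cdot> b \<cdot> x\<close>; this
  form restores its use there.\<close>

lemma comp_cong_left:
  "a \<cdot> b = c \<Longrightarrow> arr a \<Longrightarrow> arr b \<Longrightarrow> arr x \<Longrightarrow> src a = tgt b \<Longrightarrow> src b = tgt x \<Longrightarrow> a \<cdot> b \<cdot> x = c \<cdot> x"
  by (metis comp_assoc)

section \<open>Zero morphisms\<close>

lemma zero_objD:
  assumes "zero_obj C z" "a \<in> Obj C"
  shows "\<exists>f. f \<in> Hom C z a" "\<exists>f. f \<in> Hom C a z"
    "f \<in> Hom C z a \<Longrightarrow> g \<in> Hom C z a \<Longrightarrow> f = g" "f \<in> Hom C a z \<Longrightarrow> g \<in> Hom C a z \<Longrightarrow> f = g"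
  using assms unfolding zero_obj_def by metis+

text \<open>The two factorizations may use different zero objects \<open>z\<close> and
  \<open>z'\<close>; the morphism \<open>t\<close> from \<open>z\<close> to \<open>z'\<close> is
  compatible with both, so they give the same composite.\<close>

lemma is_zero_unique:
  assumes "is_zero C a b f" "is_zero C a b g" shows "f = g"
proof -
  obtain z h k where z: "zero_obj C z" "h \<in> Hom C a z" "k \<in> Hom C z b" "f = k \<cdot> h"
    using assms(1) unfolding is_zero_def by blast
  obtain z' h' k' where z': "zero_obj C z'" "h' \<in> Hom C a z'" "k' \<in> Hom C z' b" "g = k' \<cdot> h'"
    using assms(2) unfolding is_zero_def by blast
  obtain t where t: "t \<in> Hom C z z'"
    using zero_objD(1)[OF z(1)] Hom_Obj[OF z'(2)] by blast
  have "t \<cdot> h = h'"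
    using zero_objD(4)[OF z'(1)] comp_in_Hom[OF t z(2)] z'(2) Hom_Obj[OF z(2)] by blast
  moreover have "k' \<cdot> t = k"
    using zero_objD(3)[OF z(1)] comp_in_Hom[OF z'(3) t] z(3) Hom_Obj[OF z(3)] by blast
  ultimately show ?thesis
    using z z' t comp_assoc[of k' t h] by (auto simp: in_Hom)
qed

text \<open>Existence and uniqueness of zero morphisms turn the predicate into an equation with
  \<open>zm\<close>, fit for rewriting.\<close>

lemma is_zero_iff: "is_zero C a b f \<longleftrightarrow> a \<in> Obj C \<and> b \<in> Obj C \<and> f = zm a b"
proof -
  have "\<exists>f. is_zero C a b f" if ab: "a \<in> Obj C" "b \<in> Obj C"
  proof -
    obtain z where z: "zero_obj C z" using abelian unfolding abelian_category_def by blast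
    then obtain g h where "g \<in> Hom C a z" "h \<in> Hom C z b"
      using ab zero_objD(1,2) by blast
    then show ?thesis using z comp_in_Hom unfolding is_zero_def by blast
  qed
  moreover have "a \<in> Obj C \<and> b \<in> Obj C" if "is_zero C a b f"
    using that Hom_Obj unfolding is_zero_def by blast
  moreover have "zm a b = f" if "is_zero C a b f" for f
    using that is_zero_unique unfolding zm_def by blast
  ultimately show ?thesis by metis
qed

lemma zm_arr [simp]:
  assumes "a \<in> Obj C" "b \<in> Obj C"
  shows "arr (zm a b)" "src (zm a b) = a" "tgt (zm a b) = b"
  using is_zero_iff[of a b "zm a b"] assms by (auto simp: is_zero_def in_Hom)

lemma comp_zm [simp]:
  assumes "arr f" "a \<in> Obj C"
  shows "src f = b \<Longrightarrow> f \<cdot> zm a b = zm a (tgt f)" "tgt f = b \<Longrightarrow> zm b a \<cdot> f = zm (src f) a"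
proof -
  show "f \<cdot> zm a b = zm a (tgt f)" if "src f = b"
  proof -
    have "b \<in> Obj C" using assms that by auto
    then obtain z g h where z: "zero_obj C z" "g \<in> Hom C a z" "h \<in> Hom C z b" "zm a b = h \<cdot> g"
      using is_zero_iff[of a b "zm a b"] assms by (auto simp: is_zero_def)
    have "f \<cdot> zm a b = (f \<cdot> h) \<cdot> g" "f \<cdot> h \<in> Hom C z (tgt f)" "f \<cdot> zm a b \<in> Hom C a (tgt f)"
      using z assms that by (auto simp: in_Hom)
    then have "is_zero C a (tgt f) (f \<cdot> zm a b)" using z unfolding is_zero_def by blast
    then show ?thesis by (simp add: is_zero_iff)
  qed
  show "zm b a \<cdot> f = zm (src f) a" if "tgt f = b"
  proof -
    have "b \<in> Obj C" using assms that by auto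
    then obtain z g h where z: "zero_obj C z" "g \<in> Hom C b z" "h \<in> Hom C z a" "zm b a = h \<cdot> g"
      using is_zero_iff[of b a "zm b a"] assms by (auto simp: is_zero_def)
    have "zm b a \<cdot> f = h \<cdot> (g \<cdot> f)" "g \<cdot> f \<in> Hom C (src f) z" "zm b a \<cdot> f \<in> Hom C (src f) a"
      using z assms that by (auto simp: in_Hom)
    then have "is_zero C (src f) a (zm b a \<cdot> f)" using z unfolding is_zero_def by blast
    then show ?thesis by (simp add: is_zero_iff)
  qed
qed

section \<open>Monomorphisms, epimorphisms, kernels and cokernels\<close>

lemma monoD: "mono C a b f \<Longrightarrow> arr g \<Longrightarrow> arr h \<Longrightarrow> src g = src h \<Longrightarrow> tgt g = a \<Longrightarrow> tgt h = a
   \<Longrightarrow> f \<cdot> g = f \<cdot> h \<Longrightarrow> g = h"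
  unfolding mono_def by (metis in_Hom)

lemma epiD: "epi C a b f \<Longrightarrow> arr g \<Longrightarrow> arr h \<Longrightarrow> tgt g = tgt h \<Longrightarrow> src g = b \<Longrightarrow> src h = b
   \<Longrightarrow> g \<cdot> f = h \<cdot> f \<Longrightarrow> g = h"
  unfolding epi_def by (metis in_Hom)

lemma split_mono:
  assumes "i \<in> Hom C a b" "r \<in> Hom C b a" "r \<cdot> i = idm C a" shows "mono C a b i"
  unfolding mono_def
proof (intro conjI allI impI)
  fix x g h assume "g \<in> Hom C x a" "h \<in> Hom C x a" "i \<cdot> g = i \<cdot> h"
  then show "g = h"
    using assms comp_assoc[of r i g] comp_assoc[of r i h] by (simp add: in_Hom)
qed (use assms in simp)

lemma split_epi:
  assumes "p \<in> Hom C a b" "s \<in> Hom C b a" "p \<cdot> s = idm C b" shows "epi C a b p"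
  unfolding epi_def
proof (intro conjI allI impI)
  fix x g h assume gh: "g \<in> Hom C b x" "h \<in> Hom C b x" "g \<cdot> p = h \<cdot> p"
  have "g = (g \<cdot> p) \<cdot> s" "h = (h \<cdot> p) \<cdot> s" using assms gh(1,2) by (simp_all add: in_Hom)
  then show "g = h" using gh(3) by simp
qed (use assms in simp)

lemma epi_comp:
  assumes "epi C a b f" "epi C b c g" shows "epi C a c (g \<cdot> f)"
  unfolding epi_def
proof (intro conjI allI impI)
  have fg: "f \<in> Hom C a b" "g \<in> Hom C b c" using assms by (auto simp: epi_def)
  then show "g \<cdot> f \<in> Hom C a c" by (simp add: comp_in_Hom)
  fix x u v assume *: "u \<in> Hom C c x" "v \<in> Hom C c x" "u \<cdot> g \<cdot> f = v \<cdot> g \<cdot> f"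
  then have "(u \<cdot> g) \<cdot> f = (v \<cdot> g) \<cdot> f" using fg by (simp add: in_Hom)
  then have "u \<cdot> g = v \<cdot> g" using epiD[OF assms(1), of "u \<cdot> g" "v \<cdot> g"] fg * by (simp add: in_Hom)
  then show "u = v" using epiD[OF assms(2)] * by (simp add: in_Hom)
qed

text \<open>Uniqueness of the factorization is delegated to \<open>mono\<close>, so that only its
  existence has to be shown.\<close>

lemma kernelI:
  assumes "k \<in> Hom C K a" "f \<in> Hom C a b" "f \<cdot> k = zm K b" "mono C K a k"
    and "\<And>x g. g \<in> Hom C x a \<Longrightarrow> f \<cdot> g = zm x b \<Longrightarrow> \<exists>u \<in> Hom C x K. k \<cdot> u = g"
  shows "is_kernel C k K a f b"
  unfolding is_kernel_def
proof (intro conjI allI impI)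
  show "is_zero C K b (f \<cdot> k)" using assms(1-3) by (auto simp: is_zero_iff in_Hom)
  fix x g assume g: "g \<in> Hom C x a" "is_zero C x b (f \<cdot> g)"
  then obtain u where "u \<in> Hom C x K" "k \<cdot> u = g" using assms(5) by (auto simp: is_zero_iff)
  then show "\<exists>!u. u \<in> Hom C x K \<and> k \<cdot> u = g"
    using assms(4) unfolding mono_def by metis
qed (use assms in auto)

lemma kernelD:
  assumes "is_kernel C k K a f b"
  shows "k \<in> Hom C K a" "f \<in> Hom C a b" "f \<cdot> k = zm K b" "mono C K a k"
proof -
  show *: "k \<in> Hom C K a" "f \<in> Hom C a b" "f \<cdot> k = zm K b"
    using assms unfolding is_kernel_def is_zero_iff by auto
  show "mono C K a k" unfolding mono_def
  proof (intro conjI allI impI)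
    fix x g h assume gh: "g \<in> Hom C x K" "h \<in> Hom C x K" "k \<cdot> g = k \<cdot> h"
    have "k \<cdot> g \<in> Hom C x a" "is_zero C x b (f \<cdot> k \<cdot> g)"
      using gh * comp_cong_left[OF *(3), of g] by (auto simp: in_Hom is_zero_iff)
    then show "g = h" using assms gh unfolding is_kernel_def by metis
  qed (use * in simp)
qed

lemma kernel_factor:
  assumes "is_kernel C k K a f b" "arr g" "tgt g = a" "f \<cdot> g = zm (src g) b"
  shows "\<exists>u. arr u \<and> src u = src g \<and> tgt u = K \<and> k \<cdot> u = g"
proof -
  have "g \<in> Hom C (src g) a" "is_zero C (src g) b (f \<cdot> g)"
    using assms kernelD(2)[OF assms(1)] by (auto simp: in_Hom is_zero_iff)
  then show ?thesis using assms(1) unfolding is_kernel_def by (metis in_Hom)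
qed

lemma cokernelD:
  assumes "is_cokernel C c Q b f a"
  shows "c \<in> Hom C b Q" "f \<in> Hom C a b" "c \<cdot> f = zm a Q" "epi C b Q c"
proof -
  show *: "c \<in> Hom C b Q" "f \<in> Hom C a b" "c \<cdot> f = zm a Q"
    using assms unfolding is_cokernel_def is_zero_iff by auto
  show "epi C b Q c"
    using abelian.kernelD(4)[OF op_abelian, of c Q b f a] assms by simp
qed

lemma cokernel_factor:
  assumes "is_cokernel C c Q b f a" "arr g" "src g = b" "g \<cdot> f = zm a (tgt g)"
  shows "\<exists>u. arr u \<and> tgt u = tgt g \<and> src u = Q \<and> u \<cdot> c = g"
proof -
  have "g \<in> Hom C b (tgt g)" "is_zero C a (tgt g) (g \<cdot> f)"
    using assms cokernelD(2)[OF assms(1)] by (auto simp: in_Hom is_zero_iff)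
  then show ?thesis using assms(1) unfolding is_cokernel_def by (metis in_Hom)
qed

lemma cokernelI:
  assumes "c \<in> Hom C b Q" "f \<in> Hom C a b" "c \<cdot> f = zm a Q" "epi C b Q c"
    and "\<And>x g. g \<in> Hom C b x \<Longrightarrow> g \<cdot> f = zm a x \<Longrightarrow> \<exists>u \<in> Hom C Q x. u \<cdot> c = g"
  shows "is_cokernel C c Q b f a"
  unfolding is_cokernel_def
proof (intro conjI allI impI)
  show "is_zero C a Q (c \<cdot> f)" using assms(1-3) by (auto simp: is_zero_iff in_Hom)
  fix x g assume g: "g \<in> Hom C b x" "is_zero C a x (g \<cdot> f)"
  then obtain u where "u \<in> Hom C Q x" "u \<cdot> c = g" using assms(5) by (auto simp: is_zero_iff)
  then show "\<exists>!u. u \<in> Hom C Q x \<and> u \<cdot> c = g"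
    using assms(4) unfolding epi_def by metis
qed (use assms in auto)

lemma kernel_exists:
  assumes "f \<in> Hom C a b" obtains k K where "is_kernel C k K a f b"
  using assms abelian unfolding abelian_category_def by blast

lemma cokernel_exists:
  assumes "f \<in> Hom C a b" obtains c Q where "is_cokernel C c Q b f a"
  using assms abelian unfolding abelian_category_def by blast

text \<open>Freyd's axiom makes \<open>f\<close> a kernel of some \<open>g\<close>. Since
  \<open>g\<close> kills \<open>f\<close>, it factors through the cokernel \<open>c\<close>;
  whatever \<open>c\<close> kills is thus killed by \<open>g\<close> and factors through
  \<open>f\<close>.\<close>

lemma mono_is_kernel_of_cokernel:
  assumes "mono C a b f" "is_cokernel C c Q b f a"
  shows "is_kernel C f a b c Q"
proof (rule kernelI)
  obtain g d where g: "is_kernel C f a b g d"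
    using assms(1) abelian unfolding abelian_category_def by blast
  note c = cokernelD[OF assms(2)] and g' = kernelD[OF g]
  fix x y assume y: "y \<in> Hom C x b" "c \<cdot> y = zm x Q"
  obtain u where u: "arr u" "tgt u = d" "src u = Q" "u \<cdot> c = g"
    using cokernel_factor[OF assms(2), of g] g' by (auto simp: in_Hom)
  have "g \<cdot> y = u \<cdot> c \<cdot> y" using u y c by (auto simp: in_Hom)
  also have "\<dots> = zm x d" using y u by (auto simp: in_Hom)
  finally show "\<exists>u \<in> Hom C x a. f \<cdot> u = y"
    using kernel_factor[OF g, of y] y by (auto simp: in_Hom)
qed (use cokernelD[OF assms(2)] assms(1) in auto)

lemma epi_is_cokernel_of_kernel:
  assumes "epi C a b f" "is_kernel C k K a f b"
  shows "is_cokernel C f b a k K"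
  using abelian.mono_is_kernel_of_cokernel[OF op_abelian, of b a f k K] assms by simp

text \<open>The cokernel of an epi is zero, so it kills the identity of \<open>b\<close>, which
  therefore factors through \<open>f\<close>, the kernel of that cokernel. Cancelling the mono makes
  the right inverse two-sided.\<close>

lemma mono_epi_iso:
  assumes "mono C a b f" "epi C a b f"
  obtains g where "g \<in> Hom C b a" "f \<cdot> g = idm C b" "g \<cdot> f = idm C a"
proof -
  have f: "f \<in> Hom C a b" using assms by (simp add: mono_def)
  obtain c Q where c: "is_cokernel C c Q b f a" using cokernel_exists[OF f] .
  note c' = cokernelD[OF c]
  have "c = zm b Q"
    using epiD[OF assms(2), of c "zm b Q"] c' by (auto simp: in_Hom)
  then obtain g where g: "arr g" "src g = b" "tgt g = a" "f \<cdot> g = idm C b"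
    using kernel_factor[OF mono_is_kernel_of_cokernel[OF assms(1) c], of "idm C b"] c' f
    by (auto simp: in_Hom)
  have "f \<cdot> g \<cdot> f = f \<cdot> idm C a" using comp_cong_left[OF g(4), of f] g f by (auto simp: in_Hom)
  then have "g \<cdot> f = idm C a"
    using monoD[OF assms(1), of "g \<cdot> f" "idm C a"] g f by (auto simp: in_Hom)
  then show ?thesis using that g by (simp add: in_Hom)
qed

section \<open>Products, coproducts and equalizers\<close>

lemma product_exists:
  assumes "a \<in> Obj C" "b \<in> Obj C" obtains P p q where "is_product C P p q a b"
  using assms abelian unfolding abelian_category_def by blast

lemma productD:
  assumes "is_product C P p q a b"
  shows "p \<in> Hom C P a" "q \<in> Hom C P b"
  using assms unfolding is_product_def by auto

lemma product_pair:
  assumes "is_product C P p q a b" "arr f" "arr g" "src f = src g" "tgt f = a" "tgt g = b"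
  shows "\<exists>u. arr u \<and> src u = src f \<and> tgt u = P \<and> p \<cdot> u = f \<and> q \<cdot> u = g"
  using assms unfolding is_product_def in_Hom by metis

lemma product_eqI:
  assumes "is_product C P p q a b" "arr u" "arr v" "src u = src v" "tgt u = P" "tgt v = P"
    "p \<cdot> u = p \<cdot> v" "q \<cdot> u = q \<cdot> v"
  shows "u = v"
proof -
  have "\<exists>!w. w \<in> Hom C (src u) P \<and> p \<cdot> w = p \<cdot> u \<and> q \<cdot> w = q \<cdot> u"
    by (rule assms(1)[unfolded is_product_def, THEN conjunct2, THEN conjunct2, rule_format])
      (use assms productD[OF assms(1)] in \<open>auto simp: in_Hom\<close>)
  then show ?thesis using assms by (metis in_Hom)
qed

lemma coproduct_exists:
  assumes "a \<in> Obj C" "b \<in> Obj C" obtains S i j where "is_coproduct C S i j a b"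
  using assms abelian unfolding abelian_category_def by blast

lemma coproductD:
  assumes "is_coproduct C S i j a b"
  shows "i \<in> Hom C a S" "j \<in> Hom C b S"
  using assms unfolding is_coproduct_def by auto

lemma coproduct_copair:
  assumes "is_coproduct C S i j a b" "arr f" "arr g" "tgt f = tgt g" "src f = a" "src g = b"
  shows "\<exists>u. arr u \<and> tgt u = tgt f \<and> src u = S \<and> u \<cdot> i = f \<and> u \<cdot> j = g"
  using assms unfolding is_coproduct_def in_Hom by metis

lemma coproduct_eqI:
  assumes "is_coproduct C S i j a b" "arr u" "arr v" "tgt u = tgt v" "src u = S" "src v = S"
    "u \<cdot> i = v \<cdot> i" "u \<cdot> j = v \<cdot> j"
  shows "u = v"
proof -
  have "\<exists>!w. w \<in> Hom C S (tgt u) \<and> w \<cdot> i = u \<cdot> i \<and> w \<cdot> j = u \<cdot> j"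
    by (rule assms(1)[unfolded is_coproduct_def, THEN conjunct2, THEN conjunct2, rule_format])
      (use assms coproductD[OF assms(1)] in \<open>auto simp: in_Hom\<close>)
  then show ?thesis using assms by (metis in_Hom)
qed

text \<open>The equalizer of \<open>f\<close> and \<open>g\<close> is the preimage under \<open>(f, g)\<close> of the diagonal of \<open>b \<times> b\<close>,
  and the diagonal, being a monomorphism, is the kernel of its cokernel.\<close>

lemma equalizer_exists:
  assumes f: "f \<in> Hom C a b" and g: "g \<in> Hom C a b"
  obtains q J where "mono C J a q" "f \<cdot> q = g \<cdot> q"
    "\<And>x. arr x \<Longrightarrow> tgt x = a \<Longrightarrow> f \<cdot> x = g \<cdot> x \<Longrightarrow> \<exists>u \<in> Hom C (src x) J. q \<cdot> u = x"
proof -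
  have b: "b \<in> Obj C" using f by (auto simp: in_Hom)
  obtain P p p' where P: "is_product C P p p' b b" using product_exists[OF b b] .
  note p = productD[OF P]
  obtain D where D: "arr D" "src D = b" "tgt D = P" "p \<cdot> D = idm C b" "p' \<cdot> D = idm C b"
    using product_pair[OF P, of "idm C b" "idm C b"] b by auto
  have DH: "D \<in> Hom C b P" using D by (simp add: in_Hom)
  have mD: "mono C b P D" using split_mono[of D b P p] D p by (simp add: in_Hom)
  obtain c Q where c: "is_cokernel C c Q P D b" using cokernel_exists[OF DH] .
  have kD: "is_kernel C D b P c Q" using mono_is_kernel_of_cokernel[OF mD c] .
  note c' = cokernelD[OF c]
  obtain h where h: "arr h" "src h = a" "tgt h = P" "p \<cdot> h = f" "p' \<cdot> h = g"
    using product_pair[OF P, of f g] f g by (auto simp: in_Hom)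
  have "c \<cdot> h \<in> Hom C a Q" using h c' by (simp add: in_Hom)
  then obtain q J where q: "is_kernel C q J a (c \<cdot> h) Q" using kernel_exists by blast
  note q' = kernelD[OF q]
  have iff: "(c \<cdot> h) \<cdot> x = zm (src x) Q \<longleftrightarrow> f \<cdot> x = g \<cdot> x" if x: "arr x" "tgt x = a" for x
  proof
    assume "(c \<cdot> h) \<cdot> x = zm (src x) Q"
    then obtain w where w: "arr w" "src w = src x" "tgt w = b" "D \<cdot> w = h \<cdot> x"
      using kernel_factor[OF kD, of "h \<cdot> x"] h x c' by (auto simp: in_Hom)
    have "f \<cdot> x = p \<cdot> D \<cdot> w" using h x p w by (auto simp: in_Hom)
    also have "\<dots> = p' \<cdot> D \<cdot> w"
      using comp_cong_left[OF D(4), of w] comp_cong_left[OF D(5), of w] w D p by (auto simp: in_Hom)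
    also have "\<dots> = g \<cdot> x" using h x p w by (auto simp: in_Hom)
    finally show "f \<cdot> x = g \<cdot> x" .
  next
    assume fg: "f \<cdot> x = g \<cdot> x"
    have "D \<cdot> f \<cdot> x = h \<cdot> x"
    proof (rule product_eqI[OF P])
      have "p \<cdot> D \<cdot> f \<cdot> x = f \<cdot> x"
        using comp_cong_left[OF D(4), of "f \<cdot> x"] D p x f by (auto simp: in_Hom)
      then show "p \<cdot> D \<cdot> f \<cdot> x = p \<cdot> h \<cdot> x" using h x p by (auto simp: in_Hom)
      have "p' \<cdot> D \<cdot> f \<cdot> x = f \<cdot> x"
        using comp_cong_left[OF D(5), of "f \<cdot> x"] D p x f by (auto simp: in_Hom)
      then show "p' \<cdot> D \<cdot> f \<cdot> x = p' \<cdot> h \<cdot> x" using h x p fg by (auto simp: in_Hom)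
    qed (use D f x h in \<open>auto simp: in_Hom\<close>)
    then have "(c \<cdot> h) \<cdot> x = c \<cdot> D \<cdot> f \<cdot> x" using h x c' by (auto simp: in_Hom)
    also have "\<dots> = zm (src x) Q"
      using comp_cong_left[OF c'(3), of "f \<cdot> x"] c' D f x by (auto simp: in_Hom)
    finally show "(c \<cdot> h) \<cdot> x = zm (src x) Q" .
  qed
  show ?thesis
  proof
    show "mono C J a q" using q' by simp
    show "f \<cdot> q = g \<cdot> q" using iff[of q] q' by (auto simp: in_Hom)
    show "\<exists>u \<in> Hom C (src x) J. q \<cdot> u = x" if "arr x" "tgt x = a" "f \<cdot> x = g \<cdot> x" for x
      using kernel_factor[OF q, of x] iff[of x] that by (auto simp: in_Hom)
  qed
qed

lemma op_arr [simp]: "abelian.arr (op_cat C) = arr" "abelian.src (op_cat C) = tgt"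
    "abelian.tgt (op_cat C) = src"
  by (auto simp: fun_eq_iff abelian.arr_def[OF op_abelian] arr_def abelian.src_def[OF op_abelian]
      src_def abelian.tgt_def[OF op_abelian] tgt_def)

lemma coequalizer_exists:
  assumes "f \<in> Hom C a b" "g \<in> Hom C a b"
  obtains q J where "epi C b J q" "q \<cdot> f = q \<cdot> g"
    "\<And>x. arr x \<Longrightarrow> src x = b \<Longrightarrow> x \<cdot> f = x \<cdot> g \<Longrightarrow> \<exists>u \<in> Hom C J (tgt x). u \<cdot> q = x"
proof (rule abelian.equalizer_exists[OF op_abelian, of f b a g])
  fix q J assume "mono (op_cat C) J b q" "cmp (op_cat C) f q = cmp (op_cat C) g q"
    "\<And>x. abelian.arr (op_cat C) x \<Longrightarrow> abelian.tgt (op_cat C) x = b \<Longrightarrow>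
       cmp (op_cat C) f x = cmp (op_cat C) g x \<Longrightarrow>
       \<exists>u \<in> Hom (op_cat C) (abelian.src (op_cat C) x) J. cmp (op_cat C) q u = x"
  then show thesis by (intro that) simp_all
qed (use assms in simp_all)

text \<open>Morphisms cannot be subtracted here, so the coequalizer \<open>w\<close> of
  \<open>u\<close> and \<open>v\<close> replaces their difference. As \<open>f\<close> factors
  through \<open>w\<close>, it kills the kernel of \<open>w\<close>, which is then zero; hence
  \<open>w\<close>, the cokernel of its kernel, has a left inverse \<open>s\<close>, and
  \<open>u = v\<close>.\<close>

lemma mono_if_kernel_zero:
  assumes f: "f \<in> Hom C a b"
    and 0: "\<And>x. arr x \<Longrightarrow> tgt x = a \<Longrightarrow> f \<cdot> x = zm (src x) b \<Longrightarrow> x = zm (src x) a"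
  shows "mono C a b f"
  unfolding mono_def
proof (intro conjI allI impI f)
  fix x u v assume uv: "u \<in> Hom C x a" "v \<in> Hom C x a" "f \<cdot> u = f \<cdot> v"
  obtain w J where w: "epi C a J w" "w \<cdot> u = w \<cdot> v"
    and w': "\<And>x. arr x \<Longrightarrow> src x = a \<Longrightarrow> x \<cdot> u = x \<cdot> v \<Longrightarrow> \<exists>t \<in> Hom C J (tgt x). t \<cdot> w = x"
    using coequalizer_exists[OF uv(1,2)] by blast
  obtain t where t: "t \<in> Hom C J b" "t \<cdot> w = f" using w'[of f] f uv by (auto simp: in_Hom)
  have wH: "w \<in> Hom C a J" using w by (simp add: epi_def)
  obtain k K where k: "is_kernel C k K a w J" using kernel_exists[OF wH] .
  note k' = kernelD[OF k]
  have "f \<cdot> k = t \<cdot> w \<cdot> k" using t wH k' by (auto simp: in_Hom)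
  then have "k = zm K a" using 0[of k] k' t by (auto simp: in_Hom)
  then obtain s where s: "arr s" "src s = J" "tgt s = a" "s \<cdot> w = idm C a"
    using cokernel_factor[OF epi_is_cokernel_of_kernel[OF w(1) k], of "idm C a"] k' f
    by (auto simp: in_Hom)
  have "u = s \<cdot> w \<cdot> u" "v = s \<cdot> w \<cdot> v"
    using comp_cong_left[OF s(4)] s uv wH by (auto simp: in_Hom)
  then show "u = v" using w(2) by simp
qed

text \<open>The projection \<open>p\<close>, zero on \<open>i\<close> and the identity on
  \<open>j\<close>, is a cokernel of \<open>i\<close>: a morphism \<open>g\<close> killing
  \<open>i\<close> equals \<open>(g \<cdot> j) \<cdot> p\<close>. As \<open>i\<close> is a split
  mono, it is the kernel of its cokernel.\<close>

lemma coproduct_kernel: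
  assumes S: "is_coproduct C S i j a b"
  obtains p where "p \<in> Hom C S b" "p \<cdot> j = idm C b" "is_kernel C i a S p b"
proof -
  note ij = coproductD[OF S]
  have ab: "a \<in> Obj C" "b \<in> Obj C" using ij by (auto simp: in_Hom)
  obtain r where r: "arr r" "tgt r = a" "src r = S" "r \<cdot> i = idm C a" "r \<cdot> j = zm b a"
    using coproduct_copair[OF S, of "idm C a" "zm b a"] ab by auto
  obtain p where p: "arr p" "tgt p = b" "src p = S" "p \<cdot> i = zm a b" "p \<cdot> j = idm C b"
    using coproduct_copair[OF S, of "zm a b" "idm C b"] ab by auto
  have "is_cokernel C p b S i a"
  proof (rule cokernelI)
    show "epi C S b p" using split_epi[of p S b j] p ij by (simp add: in_Hom)
    fix x g assume g: "g \<in> Hom C S x" "g \<cdot> i = zm a x"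
    have "(g \<cdot> j) \<cdot> p = g"
      by (rule coproduct_eqI[OF S]) (use g p ij ab in \<open>auto simp: in_Hom\<close>)
    then show "\<exists>u \<in> Hom C b x. u \<cdot> p = g" using g ij by (auto simp: in_Hom)
  qed (use p ij in \<open>auto simp: in_Hom\<close>)
  moreover have "mono C a S i" using split_mono[of i a S r] r ij by (simp add: in_Hom)
  ultimately show ?thesis using that mono_is_kernel_of_cokernel p by (simp add: in_Hom)
qed

section \<open>Split sequences and pullbacks\<close>

text \<open>The comparison map \<open>\<phi>\<close> from an abstract coproduct of \<open>K\<close>
  and \<open>P\<close> to \<open>E\<close> is shown to be both epi and mono, hence invertible, and
  the universal property is transported along it.\<close>

lemma split_epi_coproduct:
  assumes p: "p \<in> Hom C E P" and s: "s \<in> Hom C P E" and ps: "p \<cdot> s = idm C P"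
    and k: "is_kernel C k K E p P"
  shows "is_coproduct C E k s K P"
proof -
  note k' = kernelD[OF k]
  have ep: "epi C E P p" using split_epi[OF p s ps] .
  note coker = epi_is_cokernel_of_kernel[OF ep k]
  have KP: "K \<in> Obj C" "P \<in> Obj C" "E \<in> Obj C" using k' s by (auto simp: in_Hom)
  \<comment> \<open>\<open>k\<close> and \<open>s\<close> are jointly epic. Both factor through the
    equalizer \<open>q\<close> of \<open>u\<close> and \<open>v\<close>, so the cokernel
    \<open>c\<close> of \<open>q\<close> kills them. Killing \<open>k\<close>, it has the form
    \<open>t \<cdot> p\<close>; killing \<open>s\<close>, it forces \<open>t\<close> to be zero.
    Hence \<open>c\<close> is zero and \<open>q\<close> has a right inverse.\<close>
  have uniq: "u = v" if uv: "u \<in> Hom C E x" "v \<in> Hom C E x" "u \<cdot> k = v \<cdot> k" "u \<cdot> s = v \<cdot> s" for u v x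
  proof -
    obtain q J where q: "mono C J E q" "u \<cdot> q = v \<cdot> q"
      and q': "\<And>x. arr x \<Longrightarrow> tgt x = E \<Longrightarrow> u \<cdot> x = v \<cdot> x \<Longrightarrow> \<exists>t \<in> Hom C (src x) J. q \<cdot> t = x"
      using equalizer_exists[OF uv(1,2)] by blast
    have qH: "q \<in> Hom C J E" using q by (simp add: mono_def)
    obtain k1 s1 where 1: "k1 \<in> Hom C K J" "q \<cdot> k1 = k" "s1 \<in> Hom C P J" "q \<cdot> s1 = s"
      using q'[of k] q'[of s] uv k' s by (auto simp: in_Hom)
    obtain c Q where c: "is_cokernel C c Q E q J" using cokernel_exists[OF qH] .
    note c' = cokernelD[OF c]
    have ck: "c \<cdot> k = zm K Q"
      using 1 qH c' comp_cong_left[OF c'(3), of k1] by (auto simp: in_Hom)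
    have cs: "c \<cdot> s = zm P Q"
      using 1 qH c' comp_cong_left[OF c'(3), of s1] by (auto simp: in_Hom)
    obtain t where t: "arr t" "tgt t = Q" "src t = P" "t \<cdot> p = c"
      using cokernel_factor[OF coker, of c] c' ck by (auto simp: in_Hom)
    have "t = t \<cdot> p \<cdot> s" using ps t by simp
    also have "\<dots> = zm P Q" using cs t p s by (auto simp: in_Hom)
    finally have "zm P Q \<cdot> p = c" using t(4) by simp
    then have "c = zm E Q" using p Hom_Obj[OF c'(1)] by (auto simp: in_Hom)
    then obtain w where w: "arr w" "src w = E" "tgt w = J" "q \<cdot> w = idm C E"
      using kernel_factor[OF mono_is_kernel_of_cokernel[OF q(1) c], of "idm C E"] c' KP
      by (auto simp: in_Hom)
    have "u = u \<cdot> q \<cdot> w" "v = v \<cdot> q \<cdot> w" using w uv by (auto simp: in_Hom)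
    then show "u = v"
      using comp_cong_left[OF q(2), of w] w qH uv by (auto simp: in_Hom)
  qed
  obtain S i j where S: "is_coproduct C S i j K P" using coproduct_exists[OF KP(1,2)] .
  note ij = coproductD[OF S]
  obtain \<pi> where \<pi>: "\<pi> \<in> Hom C S P" "\<pi> \<cdot> j = idm C P" "is_kernel C i K S \<pi> P"
    using coproduct_kernel[OF S] .
  note \<pi>' = kernelD[OF \<pi>(3)]
  obtain \<phi> where \<phi>: "arr \<phi>" "tgt \<phi> = E" "src \<phi> = S" "\<phi> \<cdot> i = k" "\<phi> \<cdot> j = s"
    using coproduct_copair[OF S, of k s] k' s by (auto simp: in_Hom)
  \<comment> \<open>This identity drives the mono part: if \<open>\<phi>\<close> kills
    \<open>x\<close>, so does \<open>\<pi>\<close>, hence \<open>x\<close> comes from some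
    \<open>y\<close> into \<open>K\<close>, and the mono \<open>k\<close> kills
    \<open>y\<close>.\<close>
  have p\<phi>: "p \<cdot> \<phi> = \<pi>"
    by (rule coproduct_eqI[OF S]) (use ij \<pi> \<pi>' \<phi> p k' ps in \<open>auto simp: in_Hom\<close>)
  have epi: "epi C S E \<phi>"
    unfolding epi_def
  proof (intro conjI allI impI)
    fix x u v assume uv: "u \<in> Hom C E x" "v \<in> Hom C E x" "u \<cdot> \<phi> = v \<cdot> \<phi>"
    have "u \<cdot> k = (u \<cdot> \<phi>) \<cdot> i" "v \<cdot> k = (v \<cdot> \<phi>) \<cdot> i"
      "u \<cdot> s = (u \<cdot> \<phi>) \<cdot> j" "v \<cdot> s = (v \<cdot> \<phi>) \<cdot> j"
      using uv(1,2) \<phi> ij by (auto simp: in_Hom)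
    then show "u = v" using uniq[OF uv(1,2)] uv(3) by simp
  qed (use \<phi> in \<open>auto simp: in_Hom\<close>)
  have mono: "mono C S E \<phi>"
  proof (rule mono_if_kernel_zero)
    fix x assume x: "arr x" "tgt x = S" "\<phi> \<cdot> x = zm (src x) E"
    have "\<pi> \<cdot> x = p \<cdot> \<phi> \<cdot> x" using p\<phi> x \<phi> p by (auto simp: in_Hom)
    also have "\<dots> = zm (src x) P" using x p by (auto simp: in_Hom)
    finally obtain y where y: "arr y" "src y = src x" "tgt y = K" "i \<cdot> y = x"
      using kernel_factor[OF \<pi>(3), of x] x by auto
    have "k \<cdot> y = \<phi> \<cdot> i \<cdot> y" using comp_cong_left[OF \<phi>(4), of y] y \<phi> ij by (auto simp: in_Hom)
    also have "\<dots> = k \<cdot> zm (src x) K" using y x k' by (auto simp: in_Hom)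
    finally have "y = zm (src x) K" using monoD[OF k'(4), of y "zm (src x) K"] y x KP by auto
    then show "x = zm (src x) S" using y ij x by (auto simp: in_Hom)
  qed (use \<phi> in \<open>auto simp: in_Hom\<close>)
  obtain \<psi> where \<psi>: "\<psi> \<in> Hom C E S" "\<phi> \<cdot> \<psi> = idm C E" "\<psi> \<cdot> \<phi> = idm C S"
    using mono_epi_iso[OF mono epi] .
  have \<psi>k: "\<psi> \<cdot> k = i" "\<psi> \<cdot> s = j"
    using comp_cong_left[OF \<psi>(3), of i] comp_cong_left[OF \<psi>(3), of j] \<psi> \<phi> ij by (auto simp: in_Hom)
  show ?thesis
    unfolding is_coproduct_def
  proof (intro conjI allI impI)
    fix x f g assume fg: "f \<in> Hom C K x" "g \<in> Hom C P x"
    obtain h where h: "arr h" "tgt h = x" "src h = S" "h \<cdot> i = f" "h \<cdot> j = g"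
      using coproduct_copair[OF S, of f g] fg by (auto simp: in_Hom)
    show "\<exists>!u. u \<in> Hom C E x \<and> u \<cdot> k = f \<and> u \<cdot> s = g"
    proof (intro ex1I conjI)
      show "h \<cdot> \<psi> \<in> Hom C E x" "(h \<cdot> \<psi>) \<cdot> k = f" "(h \<cdot> \<psi>) \<cdot> s = g"
        using h \<psi> \<psi>k k' s by (auto simp: in_Hom)
      then show "u = h \<cdot> \<psi>" if "u \<in> Hom C E x \<and> u \<cdot> k = f \<and> u \<cdot> s = g" for u
        using uniq that by metis
    qed
  qed (use k' s in auto)
qed

lemma split_mono_product:
  assumes "i \<in> Hom C M E" "r \<in> Hom C E M" "r \<cdot> i = idm C M" "is_cokernel C c Q E i M"
  shows "is_product C E c r Q M"
  using abelian.split_epi_coproduct[OF op_abelian, of i E M r c Q] assms by simp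

text \<open>The usual equation \<open>i r + s p = id\<close> needs addition of morphisms; the two
  universal properties take its place. The four equations link the injections with the
  projections.\<close>

definition biproduct where
  "biproduct M P E i r s p \<longleftrightarrow> is_coproduct C E i s M P \<and> is_product C E r p M P \<and>
     r \<cdot> i = idm C M \<and> p \<cdot> s = idm C P \<and> r \<cdot> s = zm P M \<and> p \<cdot> i = zm M P"

lemma biproductD:
  assumes "biproduct M P E i r s p"
  shows "is_coproduct C E i s M P" "is_product C E r p M P"
    "r \<cdot> i = idm C M" "p \<cdot> s = idm C P" "r \<cdot> s = zm P M" "p \<cdot> i = zm M P"
    "i \<in> Hom C M E" "r \<in> Hom C E M" "s \<in> Hom C P E" "p \<in> Hom C E P"
  using assms coproductD productD unfolding biproduct_def by blast+

text \<open>The coproduct structure yields a retraction \<open>r\<close> of \<open>k\<close> that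
  kills \<open>s\<close> and is in fact a cokernel of \<open>s\<close>. The dual lemma, applied to
  the split mono \<open>s\<close>, then supplies the product structure.\<close>

lemma split_epi_biproduct:
  assumes p: "p \<in> Hom C E P" and s: "s \<in> Hom C P E" and ps: "p \<cdot> s = idm C P"
    and k: "is_kernel C k K E p P"
  obtains r where "biproduct K P E k r s p"
proof -
  note k' = kernelD[OF k]
  have KP: "K \<in> Obj C" "P \<in> Obj C" "E \<in> Obj C" using k' s by (auto simp: in_Hom)
  note S = split_epi_coproduct[OF assms]
  obtain r where r: "arr r" "tgt r = K" "src r = E" "r \<cdot> k = idm C K" "r \<cdot> s = zm P K"
    using coproduct_copair[OF S, of "idm C K" "zm P K"] KP by auto
  have "is_cokernel C r K E s P"
  proof (rule cokernelI)
    show "epi C E K r" using split_epi[of r E K k] r k' by (simp add: in_Hom)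
    fix x g assume g: "g \<in> Hom C E x" "g \<cdot> s = zm P x"
    have "(g \<cdot> k) \<cdot> r = g"
      by (rule coproduct_eqI[OF S]) (use g r k' s KP in \<open>auto simp: in_Hom\<close>)
    then show "\<exists>u \<in> Hom C K x. u \<cdot> r = g" using g k' by (auto simp: in_Hom)
  qed (use r s in \<open>auto simp: in_Hom\<close>)
  from split_mono_product[OF s p ps this] have "is_product C E r p K P" .
  then show ?thesis using that S r ps k' unfolding biproduct_def by simp
qed

lemma biproduct_exists:
  assumes "a \<in> Obj C" "b \<in> Obj C" obtains E i r s p where "biproduct a b E i r s p"
  using coproduct_exists[OF assms] coproduct_kernel coproductD(2) split_epi_biproduct by metis

text \<open>This brings closure under extensions to bear on biproducts. Exactness in the middle
  holds since \<open>p \<cdot> f\<close> being zero forces \<open>f = i \<cdot> r \<cdot> f\<close>,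
  by comparing both projections.\<close>

lemma biproduct_short_exact:
  assumes b: "biproduct M P E i r s p" shows "short_exact C M i E p P"
proof -
  note b' = biproductD[OF b]
  have "is_kernel C i M E p P"
  proof (rule kernelI)
    show "mono C M E i" using split_mono[of i M E r] b' by simp
    fix x f assume f: "f \<in> Hom C x E" "p \<cdot> f = zm x P"
    have "i \<cdot> r \<cdot> f = f"
      by (rule product_eqI[OF b'(2)])
        (use f b' comp_cong_left[OF b'(3), of "r \<cdot> f"] comp_cong_left[OF b'(6), of "r \<cdot> f"] in \<open>auto simp: in_Hom\<close>)
    then show "\<exists>u \<in> Hom C x M. i \<cdot> u = f" using f b' by (auto simp: in_Hom)
  qed (use b' in auto)
  moreover have "epi C E P p" using split_epi[of p E P s] b' by simp
  ultimately show ?thesis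
    unfolding short_exact_def using epi_is_cokernel_of_kernel by blast
qed

section \<open>Pullbacks\<close>

definition is_pullback where
  "is_pullback E \<pi> \<rho> p a q b c \<longleftrightarrow> p \<in> Hom C a c \<and> q \<in> Hom C b c \<and>
     \<pi> \<in> Hom C E a \<and> \<rho> \<in> Hom C E b \<and> p \<cdot> \<pi> = q \<cdot> \<rho> \<and>
     (\<forall>x f g. f \<in> Hom C x a \<longrightarrow> g \<in> Hom C x b \<longrightarrow> p \<cdot> f = q \<cdot> g \<longrightarrow>
       (\<exists>!u. u \<in> Hom C x E \<and> \<pi> \<cdot> u = f \<and> \<rho> \<cdot> u = g))"

lemma is_pullback_swap: "is_pullback E \<pi> \<rho> p a q b c \<Longrightarrow> is_pullback E \<rho> \<pi> q b p a c"
  unfolding is_pullback_def by (elim conjE) (intro conjI allI impI, assumption+, simp, metis)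

text \<open>The pullback is the equalizer of the two composites to \<open>c\<close> from the product
  of \<open>a\<close> and \<open>b\<close>.\<close>

lemma pullback_exists:
  assumes "p \<in> Hom C a c" "q \<in> Hom C b c"
  obtains E \<pi> \<rho> where "is_pullback E \<pi> \<rho> p a q b c"
proof -
  obtain P p1 p2 where P: "is_product C P p1 p2 a b"
    using product_exists Hom_Obj assms by metis
  note P' = productD[OF P]
  obtain e E where e: "mono C E P e" "(p \<cdot> p1) \<cdot> e = (q \<cdot> p2) \<cdot> e"
    and e': "\<And>x. arr x \<Longrightarrow> tgt x = P \<Longrightarrow> (p \<cdot> p1) \<cdot> x = (q \<cdot> p2) \<cdot> x \<Longrightarrow> \<exists>u \<in> Hom C (src x) E. e \<cdot> u = x"
    using equalizer_exists[OF comp_in_Hom[OF assms(1) P'(1)] comp_in_Hom[OF assms(2) P'(2)]] by blast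
  have eH: "e \<in> Hom C E P" using e by (simp add: mono_def)
  have "is_pullback E (p1 \<cdot> e) (p2 \<cdot> e) p a q b c"
    unfolding is_pullback_def
  proof (intro conjI allI impI)
    show "p1 \<cdot> e \<in> Hom C E a" "p2 \<cdot> e \<in> Hom C E b" using P' eH by (auto simp: in_Hom)
    show "p \<cdot> p1 \<cdot> e = q \<cdot> p2 \<cdot> e" using e P' eH assms by (auto simp: in_Hom)
    fix x f g assume fg: "f \<in> Hom C x a" "g \<in> Hom C x b" "p \<cdot> f = q \<cdot> g"
    obtain w where w: "arr w" "src w = x" "tgt w = P" "p1 \<cdot> w = f" "p2 \<cdot> w = g"
      using product_pair[OF P, of f g] fg by (auto simp: in_Hom)
    have "(p \<cdot> p1) \<cdot> w = p \<cdot> f" "(q \<cdot> p2) \<cdot> w = q \<cdot> g"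
      using w P' assms by (auto simp: in_Hom)
    then obtain u where u: "u \<in> Hom C x E" "e \<cdot> u = w"
      using e'[OF w(1,3)] w(2) fg(3) by auto
    show "\<exists>!u. u \<in> Hom C x E \<and> (p1 \<cdot> e) \<cdot> u = f \<and> (p2 \<cdot> e) \<cdot> u = g"
    proof (intro ex1I conjI)
      show "u \<in> Hom C x E" "(p1 \<cdot> e) \<cdot> u = f" "(p2 \<cdot> e) \<cdot> u = g"
        using u w eH P' by (auto simp: in_Hom)
      fix v assume v: "v \<in> Hom C x E \<and> (p1 \<cdot> e) \<cdot> v = f \<and> (p2 \<cdot> e) \<cdot> v = g"
      have vH: "v \<in> Hom C x E" using v by simp
      have "p1 \<cdot> e \<cdot> v = (p1 \<cdot> e) \<cdot> v" "p2 \<cdot> e \<cdot> v = (p2 \<cdot> e) \<cdot> v"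
        using vH eH P' by (auto simp: in_Hom)
      then have "p1 \<cdot> e \<cdot> v = p1 \<cdot> e \<cdot> u" "p2 \<cdot> e \<cdot> v = p2 \<cdot> e \<cdot> u"
        using v u(2) w(4,5) by simp_all
      then have "e \<cdot> v = e \<cdot> u"
        by (intro product_eqI[OF P, of "e \<cdot> v" "e \<cdot> u"]) (use u(1) vH eH in \<open>auto simp: in_Hom\<close>)
      then show "v = u" using monoD[OF e(1), of v u] u v by (auto simp: in_Hom)
    qed
  qed (use assms in auto)
  then show ?thesis using that by blast
qed

text \<open>One half of Schanuel's lemma: the lift \<open>l\<close> makes the projection
  \<open>\<pi>\<close> a split epi, and its kernel is, as in every pullback, the kernel
  \<open>K\<close> of the opposite side \<open>q\<close>.\<close>

lemma pullback_split_biproduct: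
  assumes E: "is_pullback E \<pi> \<rho> p a q b c"
    and l: "l \<in> Hom C a b" "q \<cdot> l = p" and k: "is_kernel C k K b q c"
  obtains i r s where "biproduct K a E i r s \<pi>"
proof -
  have H: "p \<in> Hom C a c" "q \<in> Hom C b c" "\<pi> \<in> Hom C E a" "\<rho> \<in> Hom C E b" "p \<cdot> \<pi> = q \<cdot> \<rho>"
    using E unfolding is_pullback_def by auto
  have U: "\<exists>!u. u \<in> Hom C x E \<and> \<pi> \<cdot> u = f \<and> \<rho> \<cdot> u = g"
    if "f \<in> Hom C x a" "g \<in> Hom C x b" "p \<cdot> f = q \<cdot> g" for x f g
    using E that unfolding is_pullback_def by blast
  note k' = kernelD[OF k]
  have O: "K \<in> Obj C" "a \<in> Obj C" using k' l Hom_Obj by blast+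
  \<comment> \<open>The section \<open>s\<close> is induced by the pair of the identity and
    \<open>l\<close>, the kernel map \<open>j\<close> below by the pair of zero and
    \<open>k\<close>.\<close>
  obtain s where s: "s \<in> Hom C a E" "\<pi> \<cdot> s = idm C a"
    using U[of "idm C a" a l] O H l by (auto simp: in_Hom)
  obtain j where j: "j \<in> Hom C K E" "\<pi> \<cdot> j = zm K a" "\<rho> \<cdot> j = k"
    using U[of "zm K a" K k] O H k' by (auto simp: in_Hom)
  have "is_kernel C j K E \<pi> a"
  proof (rule kernelI)
    show "mono C K E j" unfolding mono_def
    proof (intro conjI allI impI j(1))
      fix x u v assume uv: "u \<in> Hom C x K" "v \<in> Hom C x K" "j \<cdot> u = j \<cdot> v"
      have "k \<cdot> u = \<rho> \<cdot> j \<cdot> u" "k \<cdot> v = \<rho> \<cdot> j \<cdot> v"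
        using comp_cong_left[OF j(3), of u] comp_cong_left[OF j(3), of v] uv(1,2) j(1) H(4)
        by (auto simp: in_Hom)
      then have "k \<cdot> u = k \<cdot> v" using uv(3) by simp
      then show "u = v" using k'(4) uv(1,2) unfolding mono_def by blast
    qed
    fix x g assume g: "g \<in> Hom C x E" "\<pi> \<cdot> g = zm x a"
    have "q \<cdot> \<rho> \<cdot> g = p \<cdot> \<pi> \<cdot> g"
      using comp_cong_left[OF H(5), of g] g H(1-4) by (auto simp: in_Hom)
    also have "\<dots> = zm x c" using g H by (auto simp: in_Hom)
    finally obtain u where u: "u \<in> Hom C x K" "k \<cdot> u = \<rho> \<cdot> g"
      using kernel_factor[OF k, of "\<rho> \<cdot> g"] g H by (auto simp: in_Hom)
    have x: "x \<in> Obj C" using g(1) Hom_Obj by blast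
    have ju: "\<pi> \<cdot> j \<cdot> u = zm x a" "\<rho> \<cdot> j \<cdot> u = \<rho> \<cdot> g"
      using comp_cong_left[OF j(2), of u] comp_cong_left[OF j(3), of u] u j(1) H(3,4) O
      by (auto simp: in_Hom)
    have \<rho>g: "\<rho> \<cdot> g \<in> Hom C x b" and *: "p \<cdot> zm x a = q \<cdot> \<rho> \<cdot> g"
      using \<open>q \<cdot> \<rho> \<cdot> g = p \<cdot> \<pi> \<cdot> g\<close> g H by (auto simp: in_Hom)
    have "zm x a \<in> Hom C x a" using x O by (simp add: in_Hom)
    from U[OF this \<rho>g *] have "j \<cdot> u = g"
      using ju g comp_in_Hom[OF j(1) u(1)] by blast
    then show "\<exists>u \<in> Hom C x K. j \<cdot> u = g" using u by blast
  qed (use j H in auto)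
  then show ?thesis using split_epi_biproduct[OF H(3) s] that by blast
qed

end

section \<open>Syzygies relative to the class\<close>

locale syzygies = abelian C for C :: "('o, 'm) cat" +
  fixes \<A> \<B> :: "'o set"
  assumes sub: "\<A> \<subseteq> Obj C"
    and ext: "closed_under_extensions C \<A>"
    and epiker: "closed_under_epikernels C \<A>"
    and zero: "\<exists>z \<in> \<A>. zero_obj C z"
begin

definition proper_seq where
  "proper_seq Z i A p M \<longleftrightarrow> A \<in> \<A> \<and> is_kernel C i Z A p M \<and> epi C A M p \<and>
     (\<forall>X \<in> \<A>. \<forall>f \<in> Hom C X M. \<exists>g \<in> Hom C X A. p \<cdot> g = f) \<and>
     (\<forall>Y \<in> \<B>. \<forall>f \<in> Hom C Z Y. \<exists>g \<in> Hom C A Y. g \<cdot> i = f)"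

definition syz where "syz = {(M, Z). \<exists>i A p. proper_seq Z i A p M}"

text \<open>Instead of an isomorphism between two biproducts, one object \<open>E\<close> carries
  both decompositions. Syzygies of \<open>M\<close> and \<open>N\<close> can then be compared
  through \<open>E\<close> without transport along isomorphisms.\<close>

definition stably_iso where
  "stably_iso M N \<longleftrightarrow> (\<exists>P \<in> \<A>. \<exists>Q \<in> \<A>. \<exists>E i r s p i' r' s' p'.
     biproduct M P E i r s p \<and> biproduct N Q E i' r' s' p')"

lemma proper_seqD:
  assumes "proper_seq Z i A p M"
  shows "A \<in> \<A>" "is_kernel C i Z A p M" "epi C A M p" "i \<in> Hom C Z A" "p \<in> Hom C A M"
    "p \<cdot> i = zm Z M" "mono C Z A i"
    "X \<in> \<A> \<Longrightarrow> f \<in> Hom C X M \<Longrightarrow> \<exists>g \<in> Hom C X A. p \<cdot> g = f"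
    "Y \<in> \<B> \<Longrightarrow> f' \<in> Hom C Z Y \<Longrightarrow> \<exists>g \<in> Hom C A Y. g \<cdot> i = f'"
  using assms kernelD[of i Z A p M] unfolding proper_seq_def by blast+

text \<open>Both epis onto \<open>M\<close> start in \<open>\<A>\<close> and admit lifts from
  objects of \<open>\<A>\<close>, so each factors through the other. Their pullback thus splits in
  two ways, as \<open>Z'\<close> plus \<open>A\<close> and as \<open>Z\<close> plus
  \<open>A'\<close>.\<close>

lemma schanuel:
  assumes "(M, Z) \<in> syz" "(M, Z') \<in> syz" shows "stably_iso Z Z'"
proof -
  obtain i A p where s: "proper_seq Z i A p M" using assms(1) unfolding syz_def by blast
  obtain i' A' p' where s': "proper_seq Z' i' A' p' M" using assms(2) unfolding syz_def by blast
  note d = proper_seqD[OF s] and d' = proper_seqD[OF s']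
  obtain l where l: "l \<in> Hom C A A'" "p' \<cdot> l = p" using d'(8)[OF d(1) d(5)] by blast
  obtain l' where l': "l' \<in> Hom C A' A" "p \<cdot> l' = p'" using d(8)[OF d'(1) d'(5)] by blast
  obtain E \<pi> \<rho> where E: "is_pullback E \<pi> \<rho> p A p' A' M" using pullback_exists[OF d(5) d'(5)] .
  show ?thesis
    using pullback_split_biproduct[OF E l d'(2)]
      pullback_split_biproduct[OF is_pullback_swap[OF E] l' d(2)] d(1) d'(1)
    unfolding stably_iso_def by metis
qed

text \<open>Adding the identity of \<open>P\<close> to the epi from \<open>A\<close> onto
  \<open>M\<close> leaves the kernel unchanged; the new middle term is an extension of objects of
  \<open>\<A>\<close>.\<close>

lemma syz_biproduct:
  assumes "(M, Z) \<in> syz" and b: "biproduct M P E i r s p" and P: "P \<in> \<A>"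
  shows "(E, Z) \<in> syz"
proof -
  obtain \<iota> A \<pi> where e: "proper_seq Z \<iota> A \<pi> M" using assms(1) unfolding syz_def by blast
  note e' = proper_seqD[OF e] and b' = biproductD[OF b]
  have O: "A \<in> Obj C" "P \<in> Obj C" "Z \<in> Obj C" "M \<in> Obj C" "E \<in> Obj C"
    using e'(1,4,5) P sub b'(7) Hom_Obj by blast+
  obtain B iA rA sP pP where B: "biproduct A P B iA rA sP pP" using biproduct_exists[OF O(1,2)] .
  note B' = biproductD[OF B]
  have BA: "B \<in> \<A>"
    using biproduct_short_exact[OF B] ext e'(1) P unfolding closed_under_extensions_def by blast
  \<comment> \<open>\<open>\<beta>\<close> is the direct sum of \<open>\<pi>\<close> and the
    identity of \<open>P\<close>; the next two facts express its diagonal shape through the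
    projections.\<close>
  obtain \<beta> where \<beta>: "arr \<beta>" "tgt \<beta> = E" "src \<beta> = B" "\<beta> \<cdot> iA = i \<cdot> \<pi>" "\<beta> \<cdot> sP = s"
    using coproduct_copair[OF B'(1), of "i \<cdot> \<pi>" s] b'(7,9) e'(5) by (auto simp: in_Hom)
  have r\<beta>: "r \<cdot> \<beta> = \<pi> \<cdot> rA"
  proof (rule coproduct_eqI[OF B'(1)])
    have "(r \<cdot> \<beta>) \<cdot> iA = r \<cdot> i \<cdot> \<pi>" using \<beta> b'(8) B'(7) by (simp add: in_Hom)
    also have "\<dots> = \<pi>" using comp_cong_left[OF b'(3), of \<pi>] b'(7,8) e'(5) by (simp add: in_Hom)
    finally show "(r \<cdot> \<beta>) \<cdot> iA = (\<pi> \<cdot> rA) \<cdot> iA" using B'(3,7,8) e'(5) by (simp add: in_Hom)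
    have "(r \<cdot> \<beta>) \<cdot> sP = r \<cdot> s" using \<beta> b'(8) B'(9) by (simp add: in_Hom)
    then show "(r \<cdot> \<beta>) \<cdot> sP = (\<pi> \<cdot> rA) \<cdot> sP" using B'(5,8,9) e'(5) b'(5) O by (simp add: in_Hom)
  qed (use \<beta> b'(8) B'(8) e'(5) in \<open>auto simp: in_Hom\<close>)
  have p\<beta>: "p \<cdot> \<beta> = pP"
  proof (rule coproduct_eqI[OF B'(1)])
    have "(p \<cdot> \<beta>) \<cdot> iA = p \<cdot> i \<cdot> \<pi>" using \<beta> b'(10) B'(7) by (simp add: in_Hom)
    also have "\<dots> = zm A P"
      using comp_cong_left[OF b'(6), of \<pi>] b'(7,10) e'(5) O by (simp add: in_Hom)
    finally show "(p \<cdot> \<beta>) \<cdot> iA = pP \<cdot> iA" using B'(6) by simp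
    show "(p \<cdot> \<beta>) \<cdot> sP = pP \<cdot> sP" using \<beta> b'(4,10) B'(4,9) by (simp add: in_Hom)
  qed (use \<beta> b'(10) B'(10) in \<open>auto simp: in_Hom\<close>)
  have r\<beta>x: "r \<cdot> \<beta> \<cdot> x = \<pi> \<cdot> rA \<cdot> x" if "arr x" "tgt x = B" for x
    using comp_cong_left[OF r\<beta>, of x] that \<beta>(1-3) b'(8) B'(8) e'(5) by (simp add: in_Hom)
  have p\<beta>x: "p \<cdot> \<beta> \<cdot> x = pP \<cdot> x" if "arr x" "tgt x = B" for x
    using comp_cong_left[OF p\<beta>, of x] that \<beta>(1-3) b'(10) by (simp add: in_Hom)
  have rAiA: "rA \<cdot> iA \<cdot> x = x" if "arr x" "tgt x = A" for x
    using comp_cong_left[OF B'(3), of x] that B'(7,8) by (simp add: in_Hom)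
  have pPiA: "pP \<cdot> iA \<cdot> x = zm (src x) P" if "arr x" "tgt x = A" for x
    using comp_cong_left[OF B'(6), of x] that B'(7,10) O by (simp add: in_Hom)
  have iA\<iota>: "iA \<cdot> \<iota> \<in> Hom C Z B" using comp_in_Hom[OF B'(7) e'(4)] .
  have rA\<iota>: "rA \<cdot> iA \<cdot> \<iota> = \<iota>" using rAiA[of \<iota>] e'(4) by (simp add: in_Hom)
  have "is_kernel C (iA \<cdot> \<iota>) Z B \<beta> E"
  proof (rule kernelI)
    show "\<beta> \<cdot> iA \<cdot> \<iota> = zm Z E"
    proof -
      have "\<beta> \<cdot> iA \<cdot> \<iota> = i \<cdot> \<pi> \<cdot> \<iota>"
        using comp_cong_left[OF \<beta>(4), of \<iota>] \<beta>(1-3) B'(7) e'(4,5) b'(7) by (simp add: in_Hom)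
      then show ?thesis using e'(6) b'(7) O by (simp add: in_Hom)
    qed
    show "mono C Z B (iA \<cdot> \<iota>)"
      unfolding mono_def
    proof (intro conjI allI impI iA\<iota>)
      fix x u v assume uv: "u \<in> Hom C x Z" "v \<in> Hom C x Z" "(iA \<cdot> \<iota>) \<cdot> u = (iA \<cdot> \<iota>) \<cdot> v"
      have "\<iota> \<cdot> u = rA \<cdot> (iA \<cdot> \<iota>) \<cdot> u" "\<iota> \<cdot> v = rA \<cdot> (iA \<cdot> \<iota>) \<cdot> v"
        using rAiA[of "\<iota> \<cdot> u"] rAiA[of "\<iota> \<cdot> v"] uv(1,2) e'(4) B'(7) by (simp_all add: in_Hom)
      then have "\<iota> \<cdot> u = \<iota> \<cdot> v" using uv(3) by simp
      then show "u = v" using e'(7) uv(1,2) unfolding mono_def by blast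
    qed
    fix x f assume f: "f \<in> Hom C x B" "\<beta> \<cdot> f = zm x E"
    have x: "x \<in> Obj C" using f(1) Hom_Obj by blast
    have "\<pi> \<cdot> rA \<cdot> f = zm x M" using r\<beta>x[of f] f b'(8) x by (simp add: in_Hom)
    then obtain u where u: "u \<in> Hom C x Z" "\<iota> \<cdot> u = rA \<cdot> f"
      using kernel_factor[OF e'(2), of "rA \<cdot> f"] f(1) B'(8) by (auto simp: in_Hom)
    have pf: "pP \<cdot> f = zm x P" using p\<beta>x[of f] f b'(10) x by (simp add: in_Hom)
    have "iA \<cdot> \<iota> \<cdot> u = f"
    proof (rule product_eqI[OF B'(2)])
      have "rA \<cdot> iA \<cdot> \<iota> \<cdot> u = \<iota> \<cdot> u" using rAiA[of "\<iota> \<cdot> u"] u(1) e'(4) by (simp add: in_Hom)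
      then show "rA \<cdot> iA \<cdot> \<iota> \<cdot> u = rA \<cdot> f" using u(2) by simp
      show "pP \<cdot> iA \<cdot> \<iota> \<cdot> u = pP \<cdot> f" using pPiA[of "\<iota> \<cdot> u"] u(1) e'(4) pf by (simp add: in_Hom)
    qed (use u(1) f(1) e'(4) B'(7) in \<open>auto simp: in_Hom\<close>)
    then show "\<exists>u \<in> Hom C x Z. (iA \<cdot> \<iota>) \<cdot> u = f"
      using u(1) e'(4) B'(7) by (auto simp: in_Hom)
  qed (use iA\<iota> \<beta> in \<open>auto simp: in_Hom\<close>)
  moreover have "epi C B E \<beta>"
    unfolding epi_def
  proof (intro conjI allI impI)
    fix x u v assume uv: "u \<in> Hom C E x" "v \<in> Hom C E x" "u \<cdot> \<beta> = v \<cdot> \<beta>"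
    have "(w \<cdot> i) \<cdot> \<pi> = (w \<cdot> \<beta>) \<cdot> iA" "w \<cdot> s = (w \<cdot> \<beta>) \<cdot> sP" if "w \<in> Hom C E x" for w
      using that \<beta> b'(7) B'(7,9) e'(5) by (simp_all add: in_Hom)
    from this[OF uv(1)] this[OF uv(2)] have *: "(u \<cdot> i) \<cdot> \<pi> = (v \<cdot> i) \<cdot> \<pi>" "u \<cdot> s = v \<cdot> s"
      using uv(3) by simp_all
    have "u \<cdot> i = v \<cdot> i"
      using e'(3) *(1) comp_in_Hom[OF uv(1) b'(7)] comp_in_Hom[OF uv(2) b'(7)]
      unfolding epi_def by blast
    then show "u = v" using coproduct_eqI[OF b'(1)] *(2) uv(1,2) by (simp add: in_Hom)
  qed (use \<beta> in \<open>auto simp: in_Hom\<close>)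
  \<comment> \<open>The lift is built componentwise: \<open>r \<cdot> f\<close> is lifted along
    \<open>\<pi>\<close>, while \<open>p \<cdot> f\<close> is kept as it is.\<close>
  moreover have "\<exists>g \<in> Hom C X B. \<beta> \<cdot> g = f" if X: "X \<in> \<A>" and f: "f \<in> Hom C X E" for X f
  proof -
    obtain g where g: "g \<in> Hom C X A" "\<pi> \<cdot> g = r \<cdot> f"
      using e'(8)[OF X comp_in_Hom[OF b'(8) f]] by blast
    obtain h where h: "arr h" "src h = X" "tgt h = B" "rA \<cdot> h = g" "pP \<cdot> h = p \<cdot> f"
      using product_pair[OF B'(2), of g "p \<cdot> f"] g(1) comp_in_Hom[OF b'(10) f]
      by (auto simp: in_Hom)
    have "\<beta> \<cdot> h = f"
      by (rule product_eqI[OF b'(2)])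
        (use r\<beta>x[OF h(1,3)] p\<beta>x[OF h(1,3)] h g(2) f \<beta>(1-3) in \<open>simp_all add: in_Hom\<close>)
    then show ?thesis using h by (auto simp: in_Hom)
  qed
  moreover have "\<exists>g \<in> Hom C B Y. g \<cdot> iA \<cdot> \<iota> = f" if Y: "Y \<in> \<B>" and f: "f \<in> Hom C Z Y" for Y f
  proof -
    obtain g where g: "g \<in> Hom C A Y" "g \<cdot> \<iota> = f" using e'(9)[OF Y f] by blast
    have "(g \<cdot> rA) \<cdot> iA \<cdot> \<iota> = f" using g rA\<iota> B'(7,8) e'(4) by (simp add: in_Hom)
    then show ?thesis using comp_in_Hom[OF g(1) B'(8)] by blast
  qed
  ultimately have "proper_seq Z (iA \<cdot> \<iota>) B \<beta> E" unfolding proper_seq_def using BA by blast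
  then show ?thesis unfolding syz_def by blast
qed

text \<open>The inclusion of \<open>P\<close> lifts along \<open>q\<close>, so \<open>P\<close> also
  splits off from \<open>B\<close>. The complement \<open>K\<close> lies in \<open>\<A>\<close> as
  an epikernel, and it maps onto \<open>M\<close> with the same kernel \<open>Z\<close>.\<close>

lemma syz_summand:
  assumes "(E, Z) \<in> syz" and b: "biproduct M P E i r s p" and P: "P \<in> \<A>"
  shows "(M, Z) \<in> syz"
proof -
  obtain \<iota> B q where e: "proper_seq Z \<iota> B q E" using assms(1) unfolding syz_def by blast
  note e' = proper_seqD[OF e] and b' = biproductD[OF b]
  have O: "B \<in> Obj C" "P \<in> Obj C" "Z \<in> Obj C" "M \<in> Obj C" "E \<in> Obj C"
    using e'(1,4,5) P sub b'(7) Hom_Obj by blast+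
  obtain s' where s': "s' \<in> Hom C P B" "q \<cdot> s' = s" using e'(8)[OF P b'(9)] by blast
  have pq: "p \<cdot> q \<in> Hom C B P" using comp_in_Hom[OF b'(10) e'(5)] .
  have pqs: "(p \<cdot> q) \<cdot> s' = idm C P" using b'(4,10) e'(5) s' by (simp add: in_Hom)
  obtain k K where k: "is_kernel C k K B (p \<cdot> q) P" using kernel_exists[OF pq] .
  note k' = kernelD[OF k]
  obtain \<rho> where K: "biproduct K P B k \<rho> s' (p \<cdot> q)" using split_epi_biproduct[OF pq s'(1) pqs k] .
  have KA: "K \<in> \<A>"
    using epiker e'(1) P k split_epi[OF pq s'(1) pqs] unfolding closed_under_epikernels_def by blast
  have KO: "K \<in> Obj C" using KA sub by blast
  have "(p \<cdot> q) \<cdot> \<iota> = zm Z P" using e'(4-6) b'(10) O by (simp add: in_Hom)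
  then obtain j where j: "j \<in> Hom C Z K" "k \<cdot> j = \<iota>"
    using kernel_factor[OF k, of \<iota>] e'(4) by (auto simp: in_Hom)
  define t where "t = r \<cdot> q \<cdot> k"
  have qk: "q \<cdot> k \<in> Hom C K E" using comp_in_Hom[OF e'(5) k'(1)] .
  have t: "t \<in> Hom C K M" unfolding t_def using comp_in_Hom[OF b'(8) qk] .
  have pqk: "p \<cdot> q \<cdot> k = zm K P" using k'(3) k'(1) b'(10) e'(5) by (simp add: in_Hom)
  have "is_kernel C j Z K t M"
  proof (rule kernelI)
    have "t \<cdot> j = r \<cdot> q \<cdot> \<iota>" unfolding t_def using b'(8) e'(5) k'(1) j by (simp add: in_Hom)
    then show "t \<cdot> j = zm Z M" using e'(6) b'(8) O by (simp add: in_Hom)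
    show "mono C Z K j"
      unfolding mono_def
    proof (intro conjI allI impI j(1))
      fix x u v assume uv: "u \<in> Hom C x Z" "v \<in> Hom C x Z" "j \<cdot> u = j \<cdot> v"
      have "\<iota> \<cdot> u = k \<cdot> j \<cdot> u" "\<iota> \<cdot> v = k \<cdot> j \<cdot> v"
        using comp_cong_left[OF j(2), of u] comp_cong_left[OF j(2), of v] uv(1,2) j(1) k'(1)
        by (simp_all add: in_Hom)
      then have "\<iota> \<cdot> u = \<iota> \<cdot> v" using uv(3) by simp
      then show "u = v" using e'(7) uv(1,2) unfolding mono_def by blast
    qed
    fix x f assume f: "f \<in> Hom C x K" "t \<cdot> f = zm x M"
    have x: "x \<in> Obj C" using f(1) Hom_Obj by blast
    have "q \<cdot> k \<cdot> f = zm x E"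
    proof (rule product_eqI[OF b'(2)])
      have "r \<cdot> q \<cdot> k \<cdot> f = zm x M"
        using f unfolding t_def using b'(8) e'(5) k'(1) by (simp add: in_Hom)
      then show "r \<cdot> q \<cdot> k \<cdot> f = r \<cdot> zm x E" using b'(8) x by (simp add: in_Hom)
      have "p \<cdot> q \<cdot> k \<cdot> f = (p \<cdot> q \<cdot> k) \<cdot> f" using f(1) b'(10) e'(5) k'(1) by (simp add: in_Hom)
      then show "p \<cdot> q \<cdot> k \<cdot> f = p \<cdot> zm x E" using pqk f(1) b'(10) x O KO by (simp add: in_Hom)
    qed (use f(1) e'(5) k'(1) x O in \<open>auto simp: in_Hom\<close>)
    then obtain u where u: "u \<in> Hom C x Z" "\<iota> \<cdot> u = k \<cdot> f"
      using kernel_factor[OF e'(2), of "k \<cdot> f"] f(1) k'(1) by (auto simp: in_Hom)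
    have "k \<cdot> j \<cdot> u = k \<cdot> f"
      using comp_cong_left[OF j(2), of u] u j(1) k'(1) by (simp add: in_Hom)
    then have "j \<cdot> u = f" using k'(4) comp_in_Hom[OF j(1) u(1)] f(1) unfolding mono_def by blast
    then show "\<exists>u \<in> Hom C x Z. j \<cdot> u = f" using u by blast
  qed (use j t in auto)
  moreover have "epi C K M t"
    unfolding epi_def
  proof (intro conjI allI impI t)
    fix x u v assume uv: "u \<in> Hom C M x" "v \<in> Hom C M x" "u \<cdot> t = v \<cdot> t"
    have x: "x \<in> Obj C" using uv(1) Hom_Obj by blast
    \<comment> \<open>A morphism out of \<open>B\<close> is determined on the summands
      \<open>K\<close> and \<open>P\<close>. There \<open>w \<cdot> r \<cdot> q\<close> is
      \<open>w \<cdot> t\<close> and zero, so \<open>w \<cdot> t\<close> determines it, and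
      \<open>r \<cdot> q\<close> is epi.\<close>
    have w: "(w \<cdot> r \<cdot> q) \<cdot> k = w \<cdot> t" "(w \<cdot> r \<cdot> q) \<cdot> s' = zm P x" "w \<cdot> r \<cdot> q \<in> Hom C B x"
      if "w \<in> Hom C M x" for w
      using that b'(5,8) e'(5) k'(1) s' O unfolding t_def by (simp_all add: in_Hom)
    have "u \<cdot> r \<cdot> q = v \<cdot> r \<cdot> q"
      using coproduct_eqI[OF biproductD(1)[OF K]] w[OF uv(1)] w[OF uv(2)] uv(3)
      by (simp add: in_Hom)
    moreover have "epi C B M (r \<cdot> q)"
      using epi_comp[OF e'(3)] split_epi[OF b'(8,7,3)] .
    ultimately show "u = v" using uv(1,2) unfolding epi_def by blast
  qed
  moreover have "\<exists>g \<in> Hom C X K. t \<cdot> g = f" if X: "X \<in> \<A>" and f: "f \<in> Hom C X M" for X f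
  proof -
    have XO: "X \<in> Obj C" using X sub by blast
    obtain g where g: "g \<in> Hom C X B" "q \<cdot> g = i \<cdot> f"
      using e'(8)[OF X comp_in_Hom[OF b'(7) f]] by blast
    \<comment> \<open>A lift of \<open>i \<cdot> f\<close> automatically lands in \<open>K\<close>,
      since \<open>p\<close> kills \<open>i\<close>.\<close>
    have "(p \<cdot> q) \<cdot> g = p \<cdot> i \<cdot> f" using g b'(10) e'(5) by (simp add: in_Hom)
    also have "\<dots> = zm X P"
      using comp_cong_left[OF b'(6), of f] f b'(7,10) O by (simp add: in_Hom)
    finally obtain h where h: "h \<in> Hom C X K" "k \<cdot> h = g"
      using kernel_factor[OF k, of g] g(1) by (auto simp: in_Hom)
    have "t \<cdot> h = r \<cdot> i \<cdot> f" unfolding t_def using h g(2) b'(8) e'(5) k'(1) by (simp add: in_Hom)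
    also have "\<dots> = f" using comp_cong_left[OF b'(3), of f] f b'(7,8) by (simp add: in_Hom)
    finally show ?thesis using h by blast
  qed
  moreover have "\<exists>g \<in> Hom C K Y. g \<cdot> j = f" if Y: "Y \<in> \<B>" and f: "f \<in> Hom C Z Y" for Y f
  proof -
    obtain g where g: "g \<in> Hom C B Y" "g \<cdot> \<iota> = f" using e'(9)[OF Y f] by blast
    have "(g \<cdot> k) \<cdot> j = f" using g j k'(1) by (simp add: in_Hom)
    then show ?thesis using comp_in_Hom[OF g(1) k'(1)] by blast
  qed
  ultimately have "proper_seq Z j K t M" unfolding proper_seq_def using KA by blast
  then show ?thesis unfolding syz_def by blast
qed

text \<open>The passage goes up from \<open>M\<close> to the common biproduct and then down to
  \<open>N\<close>.\<close>

lemma syz_stably_iso: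
  assumes "(M, Z) \<in> syz" "stably_iso M N" shows "(N, Z) \<in> syz"
  using assms syz_biproduct syz_summand unfolding stably_iso_def by metis

text \<open>The zero object in \<open>\<A>\<close> serves as the complement on both sides.\<close>

lemma stably_iso_refl: assumes "M \<in> Obj C" shows "stably_iso M M"
proof -
  obtain z where z: "z \<in> \<A>" using zero by blast
  obtain E i r s p where "biproduct M z E i r s p" using biproduct_exists[OF assms] z sub by blast
  then show ?thesis using z unfolding stably_iso_def by blast
qed

section \<open>Iterated syzygies and the Euclidean algorithm\<close>

lemma syz_relpow_stably_iso:
  assumes "M \<in> Obj C" "(M, Z) \<in> syz ^^ n" "(M, Z') \<in> syz ^^ n" shows "stably_iso Z Z'"
  using assms
proof (induction n arbitrary: Z Z')
  case 0
  then show ?case using stably_iso_refl by simp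
next
  case (Suc n)
  then obtain W W' where W: "(M, W) \<in> syz ^^ n" "(W, Z) \<in> syz" "(M, W') \<in> syz ^^ n" "(W', Z') \<in> syz"
    by auto
  \<comment> \<open>Stable isomorphism makes \<open>Z\<close> a syzygy of \<open>W'\<close> too, so
    that Schanuel's lemma compares \<open>Z\<close> and \<open>Z'\<close> over the single object
    \<open>W'\<close>.\<close>
  then have "stably_iso W W'" using Suc by blast
  then have "(W', Z) \<in> syz" using syz_stably_iso W(2) by blast
  then show ?case using schanuel W(4) by blast
qed

lemma syz_relpow_diff:
  assumes "M \<in> Obj C" "(M, M) \<in> syz ^^ n" "(M, M) \<in> syz ^^ m" "n < m"
  shows "(M, M) \<in> syz ^^ (m - n)"
proof -
  \<comment> \<open>The successor matters: a step out of \<open>N\<close> must remain, since it is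
    that step which is restarted at \<open>M\<close>.\<close>
  obtain l where l: "m = n + Suc l" using assms(4) less_iff_Suc_add by auto
  then obtain N where N: "(M, N) \<in> syz ^^ n" "(N, M) \<in> syz ^^ Suc l"
    using assms(3) unfolding l relpow_add by blast
  obtain Z where Z: "(N, Z) \<in> syz" "(Z, M) \<in> syz ^^ l" using relpow_Suc_D2[OF N(2)] by blast
  have "(M, Z) \<in> syz"
    using syz_stably_iso[OF Z(1)] syz_relpow_stably_iso[OF assms(1) N(1) assms(2)] by blast
  then show ?thesis using relpow_Suc_I2[OF _ Z(2)] l by simp
qed

lemma syz_relpow_gcd:
  assumes "M \<in> Obj C" "(M, M) \<in> syz ^^ n" "(M, M) \<in> syz ^^ m" "0 < n" "0 < m"
  shows "(M, M) \<in> syz ^^ gcd n m"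
  using assms(2-)
proof (induction "n + m" arbitrary: n m rule: less_induct)
  case less
  consider "n = m" | "n < m" | "m < n" by linarith
  then show ?case
  proof cases
    case 1 then show ?thesis using less by simp
  next
    case 2
    then have "(M, M) \<in> syz ^^ gcd n (m - n)"
      using less syz_relpow_diff[OF assms(1)] by simp
    then show ?thesis using 2 by (metis gcd.commute gcd_diff1_nat less_imp_le)
  next
    case 3
    then have "(M, M) \<in> syz ^^ gcd (n - m) m"
      using less syz_relpow_diff[OF assms(1)] by simp
    then show ?thesis using 3 by (metis gcd_diff1_nat less_imp_le)
  qed
qed

section \<open>Loops as closed paths of syzygies\<close>

lemma exact_complexD:
  assumes "exact_complex C A d"
  shows "d j \<in> Hom C (A j) (A (j - 1))" "d j \<cdot> d (j + 1) = zm (A (j + 1)) (A (j - 1))"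
    "A j \<in> Obj C"
  using assms unfolding exact_complex_def chain_complex_def is_zero_iff by blast+

text \<open>Exactness provides an epi onto some kernel object, whereas a loop prescribes the object.
  The comparison \<open>w\<close> between the two kernels is a split epi, so composing with it moves
  the epi to the prescribed one.\<close>

lemma exact_complex_epi_cycles:
  assumes ex: "exact_complex C A d" and k: "is_kernel C \<iota> K (A k) (d k) (A (k - 1))"
  obtains e where "epi C (A (k + 1)) K e" "d (k + 1) = \<iota> \<cdot> e"
proof -
  obtain \<iota>0 K0 e0 where 0: "is_kernel C \<iota>0 K0 (A k) (d k) (A (k - 1))"
    "epi C (A (k + 1)) K0 e0" "d (k + 1) = \<iota>0 \<cdot> e0"
    using ex unfolding exact_complex_def by blast
  note D = kernelD[OF k] and D0 = kernelD[OF 0(1)]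
  have e0: "e0 \<in> Hom C (A (k + 1)) K0" using 0(2) unfolding epi_def by blast
  have KO: "K \<in> Obj C" using D(1) Hom_Obj by blast
  obtain w where w: "w \<in> Hom C K0 K" "\<iota> \<cdot> w = \<iota>0"
    using kernel_factor[OF k, of \<iota>0] D0(1,3) by (auto simp: in_Hom)
  obtain w' where w': "w' \<in> Hom C K K0" "\<iota>0 \<cdot> w' = \<iota>"
    using kernel_factor[OF 0(1), of \<iota>] D(1,3) by (auto simp: in_Hom)
  have "\<iota> \<cdot> w \<cdot> w' = \<iota> \<cdot> idm C K"
    using comp_cong_left[OF w(2), of w'] w(1) w' D(1) by (simp add: in_Hom)
  then have "w \<cdot> w' = idm C K"
    using monoD[OF D(4)] w(1) w'(1) KO by (simp add: in_Hom)
  then have "epi C K0 K w" using split_epi w(1) w'(1) by blast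
  then have "epi C (A (k + 1)) K (w \<cdot> e0)" using epi_comp 0(2) by blast
  moreover have "d (k + 1) = \<iota> \<cdot> w \<cdot> e0"
    unfolding 0(3) using comp_cong_left[OF w(2), of e0] w(1) e0 D(1) by (simp add: in_Hom)
  ultimately show ?thesis using that by blast
qed

text \<open>The sequence sought has middle term \<open>A (k + 1)\<close> and epi \<open>e\<close>,
  the corestriction of the differential to the cycles \<open>K\<close>.\<close>

lemma acyclic_syz:
  assumes ex: "exact_complex C A d" and AA: "\<And>k. A k \<in> \<A>"
    and left: "Hom_left_acyclic C \<A> A d" and right: "Hom_right_acyclic C \<B> A d"
    and K: "is_kernel C \<iota> K (A k) (d k) (A (k - 1))"
    and K': "is_kernel C \<iota>' K' (A (k + 1)) (d (k + 1)) (A (k + 1 - 1))"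
  shows "(K, K') \<in> syz"
proof -
  define j where "j = k + 1"
  have kj: "k = j - 1" "k + 1 = j" unfolding j_def by simp_all
  note k = K[unfolded kj(1)] and k' = K'[unfolded kj(2)]
  note D = kernelD[OF k] and D' = kernelD[OF k'] and d = exact_complexD[OF ex]
  have KO: "K \<in> Obj C" "K' \<in> Obj C" using D(1) D'(1) Hom_Obj by blast+
  obtain e where e: "epi C (A j) K e" and de: "d j = \<iota> \<cdot> e"
    using exact_complex_epi_cycles[OF ex k] by auto
  obtain e' where e': "epi C (A (j + 1)) K' e'" and de': "d (j + 1) = \<iota>' \<cdot> e'"
    using exact_complex_epi_cycles[OF ex k'] by auto
  have eH: "e \<in> Hom C (A j) K" using e unfolding epi_def by blast
  have eH': "e' \<in> Hom C (A (j + 1)) K'" using e' unfolding epi_def by blast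
  have dex: "d j \<cdot> x = \<iota> \<cdot> e \<cdot> x" if "arr x" "tgt x = A j" for x
    unfolding de using that eH D(1) by (simp add: in_Hom)
  \<comment> \<open>As \<open>\<iota>\<close> is mono, \<open>e\<close> and \<open>d j\<close> kill
    the same morphisms.\<close>
  have "is_kernel C \<iota>' K' (A j) e K"
  proof (rule kernelI)
    show "e \<cdot> \<iota>' = zm K' K"
    proof (rule monoD[OF D(4)])
      show "\<iota> \<cdot> e \<cdot> \<iota>' = \<iota> \<cdot> zm K' K"
        using dex[of \<iota>'] D'(1,3) D(1) KO by (simp add: in_Hom)
    qed (use D'(1) eH KO in \<open>auto simp: in_Hom\<close>)
    fix x f assume f: "f \<in> Hom C x (A j)" "e \<cdot> f = zm x K"
    have "x \<in> Obj C" using f(1) Hom_Obj by blast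
    then have "d j \<cdot> f = zm x (A (j - 1))" using dex[of f] f D(1) by (simp add: in_Hom)
    then show "\<exists>u \<in> Hom C x K'. \<iota>' \<cdot> u = f"
      using kernel_factor[OF k', of f] f(1) by (auto simp: in_Hom)
  qed (use D' eH in auto)
  \<comment> \<open>\<open>\<iota> \<cdot> f\<close> is a cycle of the Hom complex, hence a boundary
    \<open>d j \<cdot> g\<close>; cancelling the mono \<open>\<iota>\<close> gives the lift.\<close>
  moreover have "\<exists>g \<in> Hom C X (A j). e \<cdot> g = f" if X: "X \<in> \<A>" and f: "f \<in> Hom C X K" for X f
  proof -
    have XO: "X \<in> Obj C" using X sub by blast
    have "d (j - 1) \<cdot> \<iota> \<cdot> f = zm X (A (j - 1 - 1))"
      using comp_cong_left[OF D(3), of f] f D(1,2) d(3) by (simp add: in_Hom)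
    then have "\<iota> \<cdot> f \<in> {f \<in> Hom C X (A (j - 1)). is_zero C X (A (j - 1 - 1)) (d (j - 1) \<cdot> f)}"
      using comp_in_Hom[OF D(1) f] d(3) XO by (simp add: is_zero_iff)
    then have "\<iota> \<cdot> f \<in> (\<lambda>g. d (j - 1 + 1) \<cdot> g) ` Hom C X (A (j - 1 + 1))"
      using left X unfolding Hom_left_acyclic_def by blast
    then obtain g where g: "g \<in> Hom C X (A j)" "\<iota> \<cdot> f = d j \<cdot> g" by auto
    have "\<iota> \<cdot> e \<cdot> g = \<iota> \<cdot> f" using dex[of g] g by (simp add: in_Hom)
    then have "e \<cdot> g = f" using monoD[OF D(4)] g(1) f eH by (simp add: in_Hom)
    then show ?thesis using g(1) by blast
  qed
  \<comment> \<open>Dually, \<open>f \<cdot> e'\<close> kills the incoming differential, so it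
    factors through \<open>d (j + 1)\<close>; cancelling the epi \<open>e'\<close> gives the
    extension.\<close>
  moreover have "\<exists>g \<in> Hom C (A j) Y. g \<cdot> \<iota>' = f" if Y: "Y \<in> \<B>" and f: "f \<in> Hom C K' Y" for Y f
  proof -
    have YO: "Y \<in> Obj C" using f Hom_Obj by blast
    have dd: "d (j + 1 + 1) \<in> Hom C (A (j + 1 + 1)) (A (j + 1))"
      using d(1)[of "j + 1 + 1"] by (simp only: add_diff_cancel_right')
    have "e' \<cdot> d (j + 1 + 1) = zm (A (j + 1 + 1)) K'"
    proof (rule monoD[OF D'(4)])
      have "\<iota>' \<cdot> e' \<cdot> d (j + 1 + 1) = d (j + 1) \<cdot> d (j + 1 + 1)"
        unfolding de' using dd D'(1) eH' by (simp add: in_Hom)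
      also have "\<dots> = zm (A (j + 1 + 1)) (A j)"
        using d(2)[of "j + 1"] by (simp only: add_diff_cancel_right')
      finally show "\<iota>' \<cdot> e' \<cdot> d (j + 1 + 1) = \<iota>' \<cdot> zm (A (j + 1 + 1)) K'"
        using D'(1) d(3) by (simp add: in_Hom)
    qed (use dd eH' KO d(3) in \<open>auto simp: in_Hom\<close>)
    then have "(f \<cdot> e') \<cdot> d (j + 1 + 1) = zm (A (j + 1 + 1)) Y"
      using f dd eH' d(3) by (simp add: in_Hom)
    then have "f \<cdot> e' \<in> {f \<in> Hom C (A (j + 1)) Y. is_zero C (A (j + 1 + 1)) Y (f \<cdot> d (j + 1 + 1))}"
      using comp_in_Hom[OF f eH'] d(3) YO by (simp add: is_zero_iff)
    then have "f \<cdot> e' \<in> (\<lambda>g. g \<cdot> d (j + 1)) ` Hom C (A (j + 1 - 1)) Y"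
      using right Y unfolding Hom_right_acyclic_def by blast
    then obtain g where g: "g \<in> Hom C (A j) Y" "f \<cdot> e' = g \<cdot> \<iota>' \<cdot> e'" by (auto simp: de')
    have "f = g \<cdot> \<iota>'"
      by (rule epiD[OF e']) (use g f D'(1) eH' in \<open>auto simp: in_Hom\<close>)
    then show ?thesis using g(1) by blast
  qed
  ultimately have "proper_seq K' \<iota>' (A j) e K" unfolding proper_seq_def using AA e by blast
  then show ?thesis unfolding syz_def by blast
qed

text \<open>The distance between the two cycle objects is kept positive: at distance zero two kernel
  objects of one differential are merely isomorphic, while the zeroth relational power demands
  equality.\<close>

lemma acyclic_syz_relpow:
  assumes ex: "exact_complex C A d" and AA: "\<And>k. A k \<in> \<A>"
    and left: "Hom_left_acyclic C \<A> A d" and right: "Hom_right_acyclic C \<B> A d"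
    and K: "is_kernel C \<iota> K (A k) (d k) (A (k - 1))"
  shows "is_kernel C \<iota>' K' (A (k + 1 + int n)) (d (k + 1 + int n)) (A (k + 1 + int n - 1)) \<Longrightarrow>
     (K, K') \<in> syz ^^ Suc n"
proof (induction n arbitrary: \<iota>' K')
  case 0
  then show ?case using acyclic_syz[OF ex AA left right K] by simp
next
  case (Suc n)
  have eq: "k + 1 + int (Suc n) = k + 1 + int n + 1" by simp
  obtain \<iota>'' K'' where K'': "is_kernel C \<iota>'' K'' (A (k + 1 + int n)) (d (k + 1 + int n)) (A (k + 1 + int n - 1))"
    using ex unfolding exact_complex_def by blast
  then have "(K'', K') \<in> syz" using acyclic_syz[OF ex AA left right K''] Suc.prems unfolding eq by blast
  then show ?case by (rule relpow_Suc_I[OF Suc.IH[OF K'']])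
qed

text \<open>One turn of the loop suffices, from the cycles in degree zero to those in degree
  \<open>r\<close>.\<close>

lemma piGP_imp_syz_relpow:
  assumes "M \<in> piGP C \<A> \<B> r" "0 < r" shows "(M, M) \<in> syz ^^ r"
proof -
  obtain A d where L: "is_loop C \<A> M r A d" "Hom_left_acyclic C \<A> A d" "Hom_right_acyclic C \<B> A d"
    using assms(1) unfolding piGP_def by blast
  have L': "exact_complex C A d" "\<And>k. A k \<in> \<A>"
    "\<And>k::int. \<exists>\<iota>. is_kernel C \<iota> M (A (k * int r)) (d (k * int r)) (A (k * int r - 1))"
    using L(1) unfolding is_loop_def by blast+
  obtain n where n: "r = Suc n" using assms(2) gr0_implies_Suc by blast
  obtain \<iota> where 0: "is_kernel C \<iota> M (A 0) (d 0) (A (0 - 1))" using L'(3)[of 0] by auto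
  have eq: "1 * int r = 0 + 1 + int n" using n by simp
  obtain \<iota>' where 1: "is_kernel C \<iota>' M (A (0 + 1 + int n)) (d (0 + 1 + int n)) (A (0 + 1 + int n - 1))"
    using L'(3)[of 1] unfolding eq by blast
  show ?thesis using acyclic_syz_relpow[OF L'(1,2) L(2,3) 0 1] n by simp
qed

lemma syz_relpow_imp_piGP:
  assumes "(M, M) \<in> syz ^^ r" "0 < r" and M: "M \<in> Obj C" shows "M \<in> piGP C \<A> \<B> r"
proof -
  obtain f where f: "f 0 = M" "f r = M" "\<And>i. i < r \<Longrightarrow> (f i, f (Suc i)) \<in> syz"
    using assms(1) unfolding relpow_fun_conv by blast
  \<comment> \<open>The closed path is repeated periodically; since both ends are \<open>M\<close>,
    the step across a multiple of \<open>r\<close> is again a step of the path.\<close>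
  define Z where "Z k = f (nat (k mod int r))" for k :: int
  have "(Z (k - 1), Z k) \<in> syz" for k
  proof -
    define j where "j = nat ((k - 1) mod int r)"
    have j: "j < r" "int j = (k - 1) mod int r"
      unfolding j_def using assms(2) by (simp_all add: nat_less_iff)
    have "k mod int r = (int j + 1) mod int r"
      unfolding j(2) by (simp add: mod_simps)
    then have "Z k = f (Suc j)"
    proof (cases "Suc j = r")
      case True
      then have "int j + 1 = int r" by simp
      then have "(int j + 1) mod int r = 0" by simp
      then show ?thesis using \<open>k mod int r = _\<close> True f(1,2) by (simp add: Z_def)
    next
      case False
      then have "(int j + 1) mod int r = int j + 1" using j(1) by simp
      then show ?thesis using \<open>k mod int r = _\<close> by (simp add: Z_def nat_add_distrib)
    qed
    moreover have "Z (k - 1) = f j" by (simp add: Z_def j_def)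
    ultimately show ?thesis using f(3)[OF j(1)] by simp
  qed
  then have "\<forall>k. \<exists>i A p. proper_seq (Z k) i A p (Z (k - 1))" unfolding syz_def by blast
  then obtain \<iota> A e where s: "\<And>k. proper_seq (Z k) (\<iota> k) (A k) (e k) (Z (k - 1))" by metis
  note s' = proper_seqD[OF s]
  \<comment> \<open>Splicing: the epi onto \<open>Z (k - 1)\<close> is followed by the inclusion
    into \<open>A (k - 1)\<close>, so that \<open>Z k\<close> becomes the object of cycles in degree
    \<open>k\<close>.\<close>
  define d where "d k = \<iota> (k - 1) \<cdot> e k" for k
  have O: "A k \<in> Obj C" "Z k \<in> Obj C" for k using s'(1) sub s'(4)[of k] Hom_Obj by blast+
  have d: "d k \<in> Hom C (A k) (A (k - 1))" for k
    unfolding d_def using comp_in_Hom[OF s'(4) s'(5)] .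
  have dS: "d (k + 1) = \<iota> k \<cdot> e (k + 1)" and eS: "epi C (A (k + 1)) (Z k) (e (k + 1))"
    "e (k + 1) \<in> Hom C (A (k + 1)) (Z k)" for k
    using s'(3,5)[of "k + 1"] by (simp_all add: d_def)
  have dx: "d k \<cdot> x = \<iota> (k - 1) \<cdot> e k \<cdot> x" if "arr x" "tgt x = A k" for x k
    unfolding d_def using that s'(4)[of "k - 1"] s'(5)[of k] by (simp add: in_Hom)
  have d_zero: "e k \<cdot> x = zm (src x) (Z (k - 1))"
    if x: "arr x" "tgt x = A k" "d k \<cdot> x = zm (src x) (A (k - 1))" for x k
    by (rule monoD[OF s'(7)[of "k - 1"]])
      (use x dx[OF x(1,2)] s'(4)[of "k - 1"] s'(5)[of k] O in \<open>simp_all add: in_Hom\<close>)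
  have ker: "is_kernel C (\<iota> k) (Z k) (A k) (d k) (A (k - 1))" for k
  proof (rule kernelI)
    show "d k \<cdot> \<iota> k = zm (Z k) (A (k - 1))"
      using dx[of "\<iota> k" k] s'(4)[of k] s'(4)[of "k - 1"] s'(6)[of k] O by (simp add: in_Hom)
    fix x g assume g: "g \<in> Hom C x (A k)" "d k \<cdot> g = zm x (A (k - 1))"
    then have "e k \<cdot> g = zm x (Z (k - 1))" using d_zero[of g k] by (simp add: in_Hom)
    then show "\<exists>u \<in> Hom C x (Z k). \<iota> k \<cdot> u = g"
      using kernel_factor[OF s'(2)[of k], of g] g(1) by (auto simp: in_Hom)
  qed (use s'(4,7) d in auto)
  have dd: "d k \<cdot> d (k + 1) = zm (A (k + 1)) (A (k - 1))" for k
    unfolding dS using comp_cong_left[OF kernelD(3)[OF ker[of k]], of "e (k + 1)"]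
      eS(2)[of k] s'(4)[of k] d[of k] O by (simp add: in_Hom)
  have "exact_complex C A d"
    unfolding exact_complex_def chain_complex_def is_zero_iff
    using O d dd ker dS eS(1) by blast
  moreover have "Z (k * int r) = M" for k using f(1) by (simp add: Z_def)
  then have "\<exists>\<iota>. is_kernel C \<iota> M (A (k * int r)) (d (k * int r)) (A (k * int r - 1))" for k
    using ker[of "k * int r"] by auto
  ultimately have "is_loop C \<A> M r A d"
    unfolding is_loop_def using s'(1) by blast
  moreover have "Hom_left_acyclic C \<A> A d"
    unfolding Hom_left_acyclic_def
  proof (intro ballI allI set_eqI iffI)
    fix X k g assume X: "X \<in> \<A>" and "g \<in> {g \<in> Hom C X (A k). is_zero C X (A (k - 1)) (d k \<cdot> g)}"
    then have g: "g \<in> Hom C X (A k)" "d k \<cdot> g = zm X (A (k - 1))" by (auto simp: is_zero_iff)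
    \<comment> \<open>A cycle factors through \<open>Z k\<close> and is then lifted along the epi
      from \<open>A (k + 1)\<close>.\<close>
    obtain u where u: "u \<in> Hom C X (Z k)" "\<iota> k \<cdot> u = g"
      using kernel_factor[OF ker[of k], of g] g by (auto simp: in_Hom)
    obtain v where v: "v \<in> Hom C X (A (k + 1))" "e (k + 1) \<cdot> v = u"
      using s'(8)[of X u "k + 1"] X u(1) by auto
    have "g = d (k + 1) \<cdot> v"
      unfolding dS using u v s'(4)[of k] eS(2)[of k] by (simp add: in_Hom)
    then show "g \<in> (\<lambda>g. d (k + 1) \<cdot> g) ` Hom C X (A (k + 1))" using v(1) by blast
  next
    fix X k g assume X: "X \<in> \<A>" and "g \<in> (\<lambda>g. d (k + 1) \<cdot> g) ` Hom C X (A (k + 1))"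
    then obtain v where v: "v \<in> Hom C X (A (k + 1))" "g = d (k + 1) \<cdot> v" by blast
    have dH: "d (k + 1) \<in> Hom C (A (k + 1)) (A k)" using d[of "k + 1"] by simp
    have "d k \<cdot> g = zm X (A (k - 1))"
      unfolding v(2) using comp_cong_left[OF dd[of k], of v] v(1) dH d[of k] O by (simp add: in_Hom)
    then show "g \<in> {g \<in> Hom C X (A k). is_zero C X (A (k - 1)) (d k \<cdot> g)}"
      using comp_in_Hom[OF dH v(1)] v(2) O X sub by (auto simp: is_zero_iff)
  qed
  moreover have "Hom_right_acyclic C \<B> A d"
    unfolding Hom_right_acyclic_def
  proof (intro ballI allI set_eqI iffI)
    fix Y k g assume Y: "Y \<in> \<B>"
      and "g \<in> {g \<in> Hom C (A k) Y. is_zero C (A (k + 1)) Y (g \<cdot> d (k + 1))}"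
    then have g: "g \<in> Hom C (A k) Y" "g \<cdot> d (k + 1) = zm (A (k + 1)) Y" by (auto simp: is_zero_iff)
    have YO: "Y \<in> Obj C" using g(1) Hom_Obj by blast
    \<comment> \<open>Cancelling the epi onto \<open>Z k\<close> shows that \<open>g\<close> kills
      \<open>\<iota> k\<close>. It therefore descends along \<open>e k\<close> to
      \<open>Z (k - 1)\<close>, from where it extends to \<open>A (k - 1)\<close>.\<close>
    have "g \<cdot> \<iota> k = zm (Z k) Y"
    proof (rule epiD[OF eS(1)])
      have "(g \<cdot> \<iota> k) \<cdot> e (k + 1) = g \<cdot> d (k + 1)"
        unfolding dS using g(1) s'(4)[of k] eS(2)[of k] by (simp add: in_Hom)
      then show "(g \<cdot> \<iota> k) \<cdot> e (k + 1) = zm (Z k) Y \<cdot> e (k + 1)"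
        using g(2) eS(2)[of k] YO by (simp add: in_Hom)
    qed (use g(1) s'(4)[of k] O YO in \<open>auto simp: in_Hom\<close>)
    then obtain u where u: "u \<in> Hom C (Z (k - 1)) Y" "u \<cdot> e k = g"
      using cokernel_factor[OF epi_is_cokernel_of_kernel[OF s'(3)[of k] s'(2)[of k]], of g] g(1)
      by (auto simp: in_Hom)
    obtain v where v: "v \<in> Hom C (A (k - 1)) Y" "v \<cdot> \<iota> (k - 1) = u"
      using s'(9)[OF Y u(1)] by blast
    have "g = v \<cdot> d k"
      unfolding d_def using comp_cong_left[OF v(2), of "e k"] u(2) v(1) s'(4)[of "k - 1"] s'(5)[of k]
      by (simp add: in_Hom)
    then show "g \<in> (\<lambda>g. g \<cdot> d k) ` Hom C (A (k - 1)) Y" using v(1) by blast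
  next
    fix Y k g assume Y: "Y \<in> \<B>" and "g \<in> (\<lambda>g. g \<cdot> d k) ` Hom C (A (k - 1)) Y"
    then obtain v where v: "v \<in> Hom C (A (k - 1)) Y" "g = v \<cdot> d k" by blast
    have YO: "Y \<in> Obj C" using v(1) Hom_Obj by blast
    have dH: "d (k + 1) \<in> Hom C (A (k + 1)) (A k)" using d[of "k + 1"] by simp
    have "g \<cdot> d (k + 1) = zm (A (k + 1)) Y"
      unfolding v(2) using dd[of k] v(1) dH d[of k] O by (simp add: in_Hom)
    then show "g \<in> {g \<in> Hom C (A k) Y. is_zero C (A (k + 1)) Y (g \<cdot> d (k + 1))}"
      using comp_in_Hom[OF v(1) d] v(2) O YO by (auto simp: is_zero_iff)
  qed
  ultimately show ?thesis unfolding piGP_def using M by blast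
qed

end

text \<open>The same complex works, because every multiple of \<open>q * r\<close> is a multiple of
  \<open>r\<close>.\<close>

lemma piGP_mult_subset: "piGP C \<A> \<B> r \<subseteq> piGP C \<A> \<B> (q * r)"
proof -
  have "is_loop C \<A> M (q * r) A d" if "is_loop C \<A> M r A d" for M A d
    unfolding is_loop_def
  proof (intro conjI allI)
    fix k :: int
    have "k * int (q * r) = (k * int q) * int r" by simp
    then show "\<exists>\<iota>. is_kernel C \<iota> M (A (k * int (q * r))) (d (k * int (q * r))) (A (k * int (q * r) - 1))"
      using that unfolding is_loop_def by metis
  qed (use that in \<open>auto simp: is_loop_def\<close>)
  then show ?thesis unfolding piGP_def by blast
qed

theorem theorem6p1:
  fixes C :: "('o, 'm) cat" and \<A> \<B> :: "'o set" and m n :: nat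
  assumes "abelian_category C"
    and "m \<ge> 1" and "n \<ge> 1"
    and "\<A> \<subseteq> Obj C" and "\<B> \<subseteq> Obj C"
    and "closed_under_extensions C \<A>"
    and "closed_under_epikernels C \<A>"
    and "\<exists>z \<in> \<A>. zero_obj C z"
    and "ext1_vanish C \<A> \<A>"
    and "ext1_vanish C \<A> \<B>"
  shows "piGP C \<A> \<B> n \<inter> piGP C \<A> \<B> m = piGP C \<A> \<B> (gcd m n)"
proof
  interpret syzygies C \<A> \<B>
    using assms by unfold_locales
  show "piGP C \<A> \<B> n \<inter> piGP C \<A> \<B> m \<subseteq> piGP C \<A> \<B> (gcd m n)"
  proof
    fix M assume M: "M \<in> piGP C \<A> \<B> n \<inter> piGP C \<A> \<B> m"
    then have MO: "M \<in> Obj C" by (simp add: piGP_def)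
    have "(M, M) \<in> syz ^^ gcd m n"
      using syz_relpow_gcd[OF MO] piGP_imp_syz_relpow M assms(2,3) by simp
    then show "M \<in> piGP C \<A> \<B> (gcd m n)"
      using syz_relpow_imp_piGP MO assms(2) by simp
  qed
  show "piGP C \<A> \<B> (gcd m n) \<subseteq> piGP C \<A> \<B> n \<inter> piGP C \<A> \<B> m"
    using piGP_mult_subset[of C \<A> \<B> "gcd m n" "n div gcd m n"]
      piGP_mult_subset[of C \<A> \<B> "gcd m n" "m div gcd m n"] by simp
qed

end
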